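(* Let $X, Y, Z$ be Banach spaces with $X\subseteq Z$ (as a closed subspace), let $\lambda\ge 1$, suppose that $X^{**}$ is a $P_\lambda$-space, and let $1<p<\infty$. (i) If $T\in K_p(X,Y)$, then there exists an extension $\widetilde T\in K_p(Z,Y)$ of $T$ with $\kappa_p(\widetilde T)\le \lambda\,\kappa_p(T)$. (ii) If $T\in W_p(X,Y)$, then there exists an extension $\widetilde T\in W_p(Z,Y)$ of $T$ with $\omega_p(\widetilde T)\le \lambda\,\omega_p(T)$.
   Context: Banach spaces are over the complex scalars; $B(X,Y)$ is the space of bounded linear operators and $B_X$ the closed unit ball. A Banach space $E$ is a $P_\lambda$-space if for every Banach space $F\supseteq E$ there is a projection $P:F\to E$ with $\|P\|\le\lambda$. For $1<p<\infty$ let $\frac1p+\frac1q=1$. $\ell_p^s(Y)$ is the space of sequences $(y_n)$ in $Y$ with $\|(y_n)\|_p^s=(\sum_n\|y_n\|^p)^{1/p}<\infty$; $\ell_p^w(Y)$ is the space of sequences $(y_n)$ in $Y$ with $\|(y_n)\|_p^w=\sup_{y^*\in B_{Y^*}}(\sum_n|y^*(y_n)|^p)^{1/p}<\infty$. For such $y=(y_n)$ define $E_y:\ell_q\to Y$ by $E_y((\alpha_n))=\sum_n\alpha_n y_n$. An operator $T\in B(X,Y)$ is $p$-compact (resp. weakly $p$-compact) if there is $y\in\ell_p^s(Y)$ (resp. $y\in\ell_p^w(Y)$) with $T(B_X)\subseteq E_y(B_{\ell_q})$; $K_p(X,Y)$ (resp. $W_p(X,Y)$) is the set of these operators, with norm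 $\kappa_p(T)=\inf\{\|y\|_p^s: y\in\ell_p^s(Y),\ T(B_X)\subseteq E_y(B_{\ell_q})\}$ (resp. $\omega_p(T)=\inf\{\|y\|_p^w: y\in\ell_p^w(Y),\ T(B_X)\subseteq E_y(B_{\ell_q})\}$). *)

theory Defs
  imports "HOL-Analysis.Analysis" "HOL-Library.Function_Algebras"
begin

class complex_vector = ab_group_add +
  fixes scaleC :: "complex \<Rightarrow> 'a \<Rightarrow> 'a"  (infixr "*\<^sub>C" 75)
  assumes scaleC_add_right: "a *\<^sub>C (x + y) = a *\<^sub>C x + a *\<^sub>C y"
    and scaleC_add_left: "(a + b) *\<^sub>C x = a *\<^sub>C x + b *\<^sub>C x"
    and scaleC_scaleC: "a *\<^sub>C b *\<^sub>C x = (a * b) *\<^sub>C x"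
    and scaleC_one: "1 *\<^sub>C x = x"

class complex_normed_vector = complex_vector + real_normed_vector +
  assumes scaleR_scaleC: "r *\<^sub>R x = complex_of_real r *\<^sub>C x"
    and norm_scaleC: "norm (a *\<^sub>C x) = cmod a * norm x"

class cbanach = complex_normed_vector + banach

global_interpretation complex_vector: vector_space "scaleC :: complex \<Rightarrow> 'a \<Rightarrow> 'a::complex_vector"
  defines csubspace = complex_vector.subspace
  by unfold_locales (simp_all add: scaleC_add_right scaleC_add_left scaleC_scaleC scaleC_one)

instantiation complex :: cbanach
begin
definition scaleC_complex :: "complex \<Rightarrow> complex \<Rightarrow> complex" where
  "scaleC_complex = (*)"
instance
  by intro_classes (simp_all add: scaleC_complex_def algebra_simps norm_mult scaleR_conv_of_real)
end

instantiation "fun" :: (type, complex_vector) complex_vector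
begin
definition scaleC_fun :: "complex \<Rightarrow> ('a \<Rightarrow> 'b) \<Rightarrow> 'a \<Rightarrow> 'b" where
  "scaleC_fun a f = (\<lambda>x. a *\<^sub>C f x)"
instance
  by intro_classes
    (simp_all add: scaleC_fun_def fun_eq_iff scaleC_add_right scaleC_add_left scaleC_scaleC scaleC_one)
end

text \<open>
  Duals, biduals and the superspaces in the definition of a $P_\lambda$-space are not available as
  types of class \<^class>\<open>cbanach\<close>. Such a space is a pair of a linear subspace \<open>V\<close> of some
  \<^class>\<open>complex_vector\<close> type and a function \<open>N\<close> that is a norm on \<open>V\<close>; the values of \<open>N\<close>,
  and of linear maps, outside \<open>V\<close> are irrelevant. A type of class \<^class>\<open>cbanach\<close> is the pair
  of \<open>UNIV\<close> and \<open>norm\<close>.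
\<close>

locale complex_normed_space_on =
  fixes V :: "'a::complex_vector set" and N :: "'a \<Rightarrow> real"
  assumes csubspace: "csubspace V"
    and nonneg: "x \<in> V \<Longrightarrow> 0 \<le> N x"
    and eq_zero_iff: "x \<in> V \<Longrightarrow> N x = 0 \<longleftrightarrow> x = 0"
    and triangle: "x \<in> V \<Longrightarrow> y \<in> V \<Longrightarrow> N (x + y) \<le> N x + N y"
    and homogeneous: "x \<in> V \<Longrightarrow> N (a *\<^sub>C x) = cmod a * N x"

locale complex_banach_space_on = complex_normed_space_on +
  assumes complete:
    "\<lbrakk>\<And>n. s n \<in> V; \<And>e. e > 0 \<Longrightarrow> \<exists>k. \<forall>m\<ge>k. \<forall>n\<ge>k. N (s m - s n) < e\<rbrakk>
      \<Longrightarrow> \<exists>x\<in>V. (\<lambda>n. N (s n - x)) \<longlonglongrightarrow> 0"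

definition clinear_on :: "'a::complex_vector set \<Rightarrow> ('a \<Rightarrow> 'b::complex_vector) \<Rightarrow> bool" where
  "clinear_on V T \<longleftrightarrow>
    (\<forall>x\<in>V. \<forall>y\<in>V. T (x + y) = T x + T y) \<and> (\<forall>a. \<forall>x\<in>V. T (a *\<^sub>C x) = a *\<^sub>C T x)"

definition bounded_ops ::
  "'a::complex_vector set \<Rightarrow> ('a \<Rightarrow> real) \<Rightarrow> 'b::complex_vector set \<Rightarrow> ('b \<Rightarrow> real) \<Rightarrow> ('a \<Rightarrow> 'b) set" where
  "bounded_ops V N W M =
    {T. T ` V \<subseteq> W \<and> clinear_on V T \<and> (\<exists>C. \<forall>x\<in>V. M (T x) \<le> C * N x)}"

definition op_norm :: "'a set \<Rightarrow> ('a \<Rightarrow> real) \<Rightarrow> ('b \<Rightarrow> real) \<Rightarrow> ('a \<Rightarrow> 'b) \<Rightarrow> real" where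
  "op_norm V N M T = (SUP x\<in>{x\<in>V. N x \<le> 1}. M (T x))"

text \<open>
  A functional on \<open>V\<close> is represented by its extension by \<open>0\<close> to the whole type. This makes the
  representation unique and the dual a linear subspace of the function type.
\<close>

definition dual :: "'a::complex_vector set \<Rightarrow> ('a \<Rightarrow> real) \<Rightarrow> ('a \<Rightarrow> complex) set" where
  "dual V N = {f \<in> bounded_ops V N UNIV norm. \<forall>x. x \<notin> V \<longrightarrow> f x = 0}"

definition dual_norm :: "'a set \<Rightarrow> ('a \<Rightarrow> real) \<Rightarrow> ('a \<Rightarrow> complex) \<Rightarrow> real" where
  "dual_norm V N = op_norm V N norm"

definition bidual :: "'a::complex_vector set \<Rightarrow> ('a \<Rightarrow> real) \<Rightarrow> (('a \<Rightarrow> complex) \<Rightarrow> complex) set" where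
  "bidual V N = dual (dual V N) (dual_norm V N)"

definition bidual_norm ::
  "'a::complex_vector set \<Rightarrow> ('a \<Rightarrow> real) \<Rightarrow> (('a \<Rightarrow> complex) \<Rightarrow> complex) \<Rightarrow> real" where
  "bidual_norm V N = dual_norm (dual V N) (dual_norm V N)"

text \<open>
  The inclusion of \<open>E\<close> in a Banach space \<open>F\<close> is an isometric linear embedding \<open>j\<close>. HOL has no
  quantification over types, so the spaces \<open>F\<close> range over all Banach spaces carried by subspaces
  of the one type \<open>('e \<Rightarrow> complex) \<Rightarrow> complex\<close>. This is no restriction: that type carries the space
  $\ell_\infty(B_{E^*})$, in which \<open>E\<close> embeds isometrically, and by the Hahn-Banach theorem
  (applied coordinatewise) the inclusion of \<open>E\<close> in $\ell_\infty(B_{E^*})$ extends, with norm \<open>1\<close>,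
  to any Banach space containing \<open>E\<close>. Composing with a projection of norm at most \<open>c\<close> from
  $\ell_\infty(B_{E^*})$ onto \<open>E\<close> gives one from the larger space.
\<close>

definition P_space :: "real \<Rightarrow> 'e::complex_vector set \<Rightarrow> ('e \<Rightarrow> real) \<Rightarrow> bool" where
  "P_space c E N \<longleftrightarrow>
    (\<forall>(F :: (('e \<Rightarrow> complex) \<Rightarrow> complex) set) M j.
      complex_banach_space_on F M \<and> j ` E \<subseteq> F \<and> clinear_on E j \<and> (\<forall>v\<in>E. M (j v) = N v) \<longrightarrow>
      (\<exists>P \<in> bounded_ops F M (j ` E) M. (\<forall>w\<in>j ` E. P w = w) \<and> op_norm F M M P \<le> c))"

definition conj_exp :: "real \<Rightarrow> real" where
  "conj_exp p = p / (p - 1)"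

lemma conj_exp: "1 < p \<Longrightarrow> 1 / p + 1 / conj_exp p = 1"
  by (simp add: conj_exp_def field_simps)

definition ell_s :: "real \<Rightarrow> (nat \<Rightarrow> 'a::complex_normed_vector) set" where
  "ell_s p = {y. summable (\<lambda>n. norm (y n) powr p)}"

definition norm_s :: "real \<Rightarrow> (nat \<Rightarrow> 'a::complex_normed_vector) \<Rightarrow> real" where
  "norm_s p y = (\<Sum>n. norm (y n) powr p) powr (1 / p)"

definition dual_ball :: "('a::complex_normed_vector \<Rightarrow> complex) set" where
  "dual_ball = {f \<in> dual UNIV norm. dual_norm UNIV norm f \<le> 1}"

definition ell_w :: "real \<Rightarrow> (nat \<Rightarrow> 'a::complex_normed_vector) set" where
  "ell_w p = {y. (\<forall>f\<in>dual_ball. summable (\<lambda>n. cmod (f (y n)) powr p)) \<and>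
    bdd_above ((\<lambda>f. (\<Sum>n. cmod (f (y n)) powr p) powr (1 / p)) ` dual_ball)}"

definition norm_w :: "real \<Rightarrow> (nat \<Rightarrow> 'a::complex_normed_vector) \<Rightarrow> real" where
  "norm_w p y = (SUP f\<in>dual_ball. (\<Sum>n. cmod (f (y n)) powr p) powr (1 / p))"

text \<open>The scalar sequence space $\ell_q$ is \<^term>\<open>ell_s q :: (nat \<Rightarrow> complex) set\<close>.\<close>

definition ell_ball :: "real \<Rightarrow> (nat \<Rightarrow> complex) set" where
  "ell_ball q = {\<alpha> \<in> ell_s q. norm_s q \<alpha> \<le> 1}"

definition E_op :: "(nat \<Rightarrow> 'a::complex_normed_vector) \<Rightarrow> (nat \<Rightarrow> complex) \<Rightarrow> 'a" where
  "E_op y \<alpha> = (\<Sum>n. \<alpha> n *\<^sub>C y n)"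

text \<open>
  The domain of an operator is a linear subspace \<open>X\<close> of a type of class \<^class>\<open>cbanach\<close>, with the
  norm of that type; the codomain is a whole type.
\<close>

definition dominates ::
  "real \<Rightarrow> 'x::complex_normed_vector set \<Rightarrow> ('x \<Rightarrow> 'y::complex_normed_vector) \<Rightarrow> (nat \<Rightarrow> 'y) \<Rightarrow> bool" where
  "dominates p X T y \<longleftrightarrow> T ` {x\<in>X. norm x \<le> 1} \<subseteq> E_op y ` ell_ball (conj_exp p)"

definition K_ops :: "real \<Rightarrow> 'x::cbanach set \<Rightarrow> ('x \<Rightarrow> 'y::cbanach) set" where
  "K_ops p X = {T \<in> bounded_ops X norm UNIV norm. \<exists>y\<in>ell_s p. dominates p X T y}"

definition W_ops :: "real \<Rightarrow> 'x::cbanach set \<Rightarrow> ('x \<Rightarrow> 'y::cbanach) set" where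
  "W_ops p X = {T \<in> bounded_ops X norm UNIV norm. \<exists>y\<in>ell_w p. dominates p X T y}"

definition kappa :: "real \<Rightarrow> 'x::cbanach set \<Rightarrow> ('x \<Rightarrow> 'y::cbanach) \<Rightarrow> real" where
  "kappa p X T = Inf {norm_s p y | y. y \<in> ell_s p \<and> dominates p X T y}"

definition omega :: "real \<Rightarrow> 'x::cbanach set \<Rightarrow> ('x \<Rightarrow> 'y::cbanach) \<Rightarrow> real" where
  "omega p X T = Inf {norm_w p y | y. y \<in> ell_w p \<and> dominates p X T y}"

end

theory Submission imports Defs begin

text \<open>
  Since $X^{**}$ is a $P_\lambda$-space, the canonical embedding of $X$ in $X^{**}$ extends to an
  operator $L : Z \to X^{**}$ with $\|L\| \le \lambda$: embed $X^{**}$ in a space of bounded functions,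
  extend coordinatewise by Hahn-Banach, and project back. The extension of $T$ is $T^{**} L$.
  If $T(B_X) \subseteq E_y(B_{\ell_q})$ for a weakly $p$-summable $y$, then $T^{**}$ has its values in $Y$ and
  maps the unit ball of $X^{**}$ into the same set $E_y(B_{\ell_q})$, because $\ell_p$ is the predual of $\ell_q$.
  Hence one extension is dominated by $\lambda y$ for every $y$ that dominates $T$, and both norm
  inequalities follow by taking infima, which need not be attained.
\<close>

section \<open>The Hahn-Banach theorem\<close>

text \<open>The infima in \<open>kappa\<close> and \<open>omega\<close> force the extension to be
  chosen before the dominating sequence. It is therefore defined weakly: \<open>T' z\<close> is the
  point whose pairing with every functional \<open>g\<close> is
  \<open>L z (adjoint_on X T g)\<close>. Functionals separate points, so this point is unique; any
  one dominating sequence shows that it exists, and every other one then represents the same point.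
  Existence rests on the estimate that the norm of \<open>g \<circ> T\<close> on \<open>X\<close> is
  at most the p-norm of the sequence \<open>g (y n)\<close>. It makes
  \<open>\<phi> (adjoint_on X T g)\<close> a bounded functional of that sequence, and its extension
  to ell_p is given by coefficients in ell_q. The factor \<lambda> is the norm bound of
  \<open>L\<close>: on the unit ball the coefficients of \<open>T' z\<close> have q-norm at most
  \<lambda>, and this factor is moved from them to \<open>y\<close>.\<close>

lemmas csubspace_memI = complex_vector.subspace_0 complex_vector.subspace_add
  complex_vector.subspace_scale complex_vector.subspace_diff complex_vector.subspace_neg

text \<open>Scaling is asked only as an inequality and only for positive reals: \<open>t\<close> and
  \<open>1 / t\<close> together give equality, and the inequality passes to infima. Real scalars
  suffice because the complex functional is recovered from its real part.\<close>

definition sublinear_on :: "'a::complex_vector set \<Rightarrow> ('a \<Rightarrow> real) \<Rightarrow> bool" where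
  "sublinear_on V F \<longleftrightarrow> (\<forall>x\<in>V. \<forall>y\<in>V. F (x + y) \<le> F x + F y) \<and>
    (\<forall>t>0. \<forall>x\<in>V. F (complex_of_real t *\<^sub>C x) \<le> t * F x)"

lemma sublinear_on_add: "sublinear_on V F \<Longrightarrow> x \<in> V \<Longrightarrow> y \<in> V \<Longrightarrow> F (x + y) \<le> F x + F y"
  by (simp add: sublinear_on_def)

lemma sublinear_on_scale_le:
  "sublinear_on V F \<Longrightarrow> t > 0 \<Longrightarrow> x \<in> V \<Longrightarrow> F (complex_of_real t *\<^sub>C x) \<le> t * F x"
  by (simp add: sublinear_on_def)

lemma sublinear_on_0:
  assumes "sublinear_on V F" and "csubspace V"
  shows "F 0 = 0"
proof -
  have "F (complex_of_real t *\<^sub>C 0) \<le> t * F 0" if "t > 0" for t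
    by (rule sublinear_on_scale_le[OF assms(1) that csubspace_memI(1)[OF assms(2)]])
  \<comment> \<open>The factor 2 gives \<open>0 \<le> F 0\<close>, the factor 1/2 gives
    \<open>F 0 \<le> 0\<close>.\<close>
  from this[of 2] this[of "1/2"] show ?thesis by simp
qed

lemma sublinear_on_scale:
  assumes F: "sublinear_on V F" and V: "csubspace V" and x: "x \<in> V" and t: "t \<ge> 0"
  shows "F (complex_of_real t *\<^sub>C x) = t * F x"
proof (cases "t = 0")
  case True
  then show ?thesis using sublinear_on_0[OF F V] by simp
next
  case False
  then have t: "t > 0" using t by simp
  have "F (complex_of_real (inverse t) *\<^sub>C complex_of_real t *\<^sub>C x) \<le> inverse t * F (complex_of_real t *\<^sub>C x)"
    using t by (intro sublinear_on_scale_le[OF F] csubspace_memI(3)[OF V x]) simp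
  moreover have "complex_of_real (inverse t) *\<^sub>C complex_of_real t *\<^sub>C x = x"
  proof -
    have "complex_of_real (inverse t) * complex_of_real t = 1" using t by simp
    then show ?thesis by (simp only: scaleC_scaleC scaleC_one)
  qed
  ultimately have "F x \<le> inverse t * F (complex_of_real t *\<^sub>C x)" by (simp only:)
  then have "t * F x \<le> t * (inverse t * F (complex_of_real t *\<^sub>C x))"
    using t by (intro mult_left_mono) auto
  also have "\<dots> = F (complex_of_real t *\<^sub>C x)"
    using t by (simp only: mult.assoc[symmetric]) simp
  finally have "t * F x \<le> F (complex_of_real t *\<^sub>C x)" .
  moreover have "F (complex_of_real t *\<^sub>C x) \<le> t * F x"
    by (rule sublinear_on_scale_le[OF F t x])
  ultimately show ?thesis by (rule antisym[rotated])
qed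

text \<open>The witness \<open>k\<close> may depend on the points as well as on the indices. For a
  chain of functionals it is the smaller member; for families indexed by a cone or a subspace it is
  the sum or the multiple of the indices.\<close>

lemma sublinear_on_INF:
  assumes I: "I \<noteq> {}"
    and below: "\<And>x. x \<in> V \<Longrightarrow> bdd_below ((\<lambda>i. F i x) ` I)"
    and add: "\<And>i j x y. i \<in> I \<Longrightarrow> j \<in> I \<Longrightarrow> x \<in> V \<Longrightarrow> y \<in> V \<Longrightarrow> \<exists>k\<in>I. F k (x + y) \<le> F i x + F j y"
    and scale: "\<And>t i x. t > 0 \<Longrightarrow> i \<in> I \<Longrightarrow> x \<in> V \<Longrightarrow> \<exists>k\<in>I. F k (complex_of_real t *\<^sub>C x) \<le> t * F i x"
    and V: "csubspace V"
  shows "sublinear_on V (\<lambda>x. INF i\<in>I. F i x)"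
  unfolding sublinear_on_def
proof (intro conjI ballI allI impI)
  fix x y assume xy: "x \<in> V" "y \<in> V"
  let ?G = "INF i\<in>I. F i (x + y)"
  have le: "?G \<le> F i x + F j y" if ij: "i \<in> I" "j \<in> I" for i j
  proof -
    obtain k where k: "k \<in> I" "F k (x + y) \<le> F i x + F j y" using add[OF ij xy] by blast
    show ?thesis
      using cINF_lower[OF below[OF csubspace_memI(2)[OF V xy]] k(1)] k(2) by (rule order_trans)
  qed
  have *: "?G - F i x \<le> (INF j\<in>I. F j y)" if "i \<in> I" for i
  proof (rule cINF_greatest[OF I])
    fix j assume "j \<in> I"
    from le[OF that this] show "?G - F i x \<le> F j y" by linarith
  qed
  then have "?G - (INF j\<in>I. F j y) \<le> (INF i\<in>I. F i x)"
  proof (intro cINF_greatest[OF I])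
    fix i assume "i \<in> I"
    from this[THEN *] show "?G - (INF j\<in>I. F j y) \<le> F i x" by linarith
  qed
  then show "?G \<le> (INF i\<in>I. F i x) + (INF i\<in>I. F i y)" by simp
next
  fix t :: real and x assume t: "0 < t" and x: "x \<in> V"
  let ?G = "INF i\<in>I. F i (complex_of_real t *\<^sub>C x)"
  have le: "?G \<le> t * F i x" if i: "i \<in> I" for i
  proof -
    obtain k where k: "k \<in> I" "F k (complex_of_real t *\<^sub>C x) \<le> t * F i x" using scale[OF t i x] by blast
    show ?thesis
      using cINF_lower[OF below[OF csubspace_memI(3)[OF V x]] k(1)] k(2) by (rule order_trans)
  qed
  have "?G / t \<le> (INF i\<in>I. F i x)"
  proof (rule cINF_greatest[OF I])
    fix i assume "i \<in> I"
    from le[OF this] show "?G / t \<le> F i x" using t by (simp only: pos_divide_le_eq mult.commute)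
  qed
  then show "?G \<le> t * (INF i\<in>I. F i x)" using t by (simp only: pos_divide_le_eq mult.commute)
qed

lemma sublinear_on_minus_ge:
  assumes "sublinear_on V F" and "csubspace V" and "x \<in> V"
  shows "- F (- x) \<le> F x"
  using sublinear_on_add[OF assms(1,3), of "- x"] csubspace_memI(5)[OF assms(2,3)]
    sublinear_on_0[OF assms(1,2)] by simp

text \<open>The Hahn-Banach theorem is obtained here by descending to a minimal sublinear functional:
  such a functional is additive.\<close>

lemma exists_minimal_sublinear:
  fixes V :: "'a::complex_vector set"
  assumes q: "sublinear_on V q" and V: "csubspace V"
  shows "\<exists>m. sublinear_on V m \<and> (\<forall>x\<in>V. m x \<le> q x) \<and>
    (\<forall>F. sublinear_on V F \<longrightarrow> (\<forall>x\<in>V. F x \<le> m x) \<longrightarrow> (\<forall>x\<in>V. F x = m x))"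
proof -
  \<comment> \<open>Functionals are normalised to vanish off \<open>V\<close>, so that the pointwise
    order on the whole type compares only values on \<open>V\<close>.\<close>
  define A where "A = {F. sublinear_on V F \<and> (\<forall>x\<in>V. F x \<le> q x) \<and> (\<forall>x. x \<notin> V \<longrightarrow> F x = 0)}"
  \<comment> \<open>The order is reversed, so the maximal element delivered by Zorn's lemma is a
    minimal functional.\<close>
  let ?P = "\<lambda>F G :: 'a \<Rightarrow> real. G \<le> F"
  let ?q = "\<lambda>x. if x \<in> V then q x else 0"
  have qA: "?q \<in> A"
    using q csubspace_memI[OF V] by (auto simp: A_def sublinear_on_def)
  have po: "partial_order_on A (relation_of ?P A)"
    by (rule partial_order_on_relation_ofI) auto
  have "\<exists>u\<in>A. \<forall>a\<in>C. ?P a u" if C: "C \<in> Chains (relation_of ?P A)" for C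
  proof (cases "C = {}")
    case True
    then show ?thesis using qA by auto
  next
    case False
    have CA: "C \<subseteq> A" and tot: "\<And>F G. F \<in> C \<Longrightarrow> G \<in> C \<Longrightarrow> F \<le> G \<or> G \<le> F"
      using C by (auto simp: Chains_def relation_of_def)
    \<comment> \<open>All members lie below \<open>q\<close>, so \<open>- F (- x) \<le> F x\<close>
      yields the common lower bound \<open>- q (- x)\<close>, and the infimum over the chain is
      finite.\<close>
    have bd: "bdd_below ((\<lambda>F. F x) ` C)" if x: "x \<in> V" for x
    proof (rule bdd_belowI2)
      fix F assume "F \<in> C"
      then have F: "sublinear_on V F" "\<forall>x\<in>V. F x \<le> q x" using CA by (auto simp: A_def)
      then show "- q (- x) \<le> F x"
        using sublinear_on_minus_ge[OF F(1) V x] csubspace_memI(5)[OF V x] by fastforce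
    qed
    have sub: "sublinear_on V (\<lambda>x. INF F\<in>C. F x)"
    proof (rule sublinear_on_INF[OF False bd _ _ V])
      fix F G x y assume FG: "F \<in> C" "G \<in> C" and xy: "x \<in> V" "y \<in> V"
      have "\<exists>H\<in>C. H \<le> F \<and> H \<le> G" using tot[OF FG] FG by auto
      then obtain H where H: "H \<in> C" "H \<le> F" "H \<le> G" by blast
      then have "sublinear_on V H" using CA by (auto simp: A_def)
      then have "H (x + y) \<le> H x + H y" using xy by (rule sublinear_on_add)
      also have "\<dots> \<le> F x + G y" using H by (intro add_mono) (auto simp: le_fun_def)
      finally show "\<exists>k\<in>C. k (x + y) \<le> F x + G y" using H by blast
    next
      fix t :: real and F x assume "t > 0" "F \<in> C" "x \<in> V"
      then show "\<exists>k\<in>C. k (complex_of_real t *\<^sub>C x) \<le> t * F x"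
        using CA by (intro bexI[of _ F]) (auto simp: A_def sublinear_on_def)
    qed
    let ?u = "\<lambda>x. if x \<in> V then INF F\<in>C. F x else 0"
    have le: "(INF F\<in>C. F x) \<le> F x" if "x \<in> V" "F \<in> C" for F x
      using bd[OF that(1)] that(2) by (rule cINF_lower)
    obtain F0 where F0: "F0 \<in> C" using False by blast
    have "?u \<in> A"
      unfolding A_def
    proof (intro CollectI conjI ballI allI impI)
      show "sublinear_on V ?u" using sub csubspace_memI[OF V] by (auto simp: sublinear_on_def)
      fix x assume x: "x \<in> V"
      have "F0 x \<le> q x" using F0 CA x by (auto simp: A_def)
      then show "?u x \<le> q x" using le[OF x F0] x by simp
    qed auto
    moreover have "?u \<le> F" if "F \<in> C" for F
      using le[OF _ that] that CA by (auto simp: le_fun_def A_def)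
    ultimately show ?thesis by blast
  qed
  from predicate_Zorn[OF po this] obtain m where m: "m \<in> A" "\<forall>a\<in>A. a \<le> m \<longrightarrow> a = m" by blast
  show ?thesis
  proof (intro exI[of _ m] conjI ballI allI impI)
    show "sublinear_on V m" "\<And>x. x \<in> V \<Longrightarrow> m x \<le> q x" using m by (auto simp: A_def)
    fix F x assume F: "sublinear_on V F" "\<forall>x\<in>V. F x \<le> m x" and x: "x \<in> V"
    let ?F = "\<lambda>x. if x \<in> V then F x else 0"
    have "sublinear_on V ?F" using F csubspace_memI[OF V] by (auto simp: sublinear_on_def)
    then have "?F \<in> A" using F m by (fastforce simp: A_def)
    moreover have "?F \<le> m" using F m by (auto simp: A_def le_fun_def)
    ultimately have "?F = m" using m by blast
    from fun_cong[OF this, of x] show "F x = m x" using x by simp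
  qed
qed

lemma exists_linear_below_sublinear:
  fixes V :: "'a::complex_vector set"
  assumes q: "sublinear_on V q" and V: "csubspace V"
  shows "\<exists>F. (\<forall>x\<in>V. \<forall>y\<in>V. F (x + y) = F x + F y) \<and>
    (\<forall>t. \<forall>x\<in>V. F (complex_of_real t *\<^sub>C x) = t * F x) \<and> (\<forall>x\<in>V. F x \<le> q x)"
proof -
  obtain m where m: "sublinear_on V m" and mq: "\<And>x. x \<in> V \<Longrightarrow> m x \<le> q x"
    and min: "\<And>F x. sublinear_on V F \<Longrightarrow> \<forall>x\<in>V. F x \<le> m x \<Longrightarrow> x \<in> V \<Longrightarrow> F x = m x"
    using exists_minimal_sublinear[OF q V] by blast
  note Vm = csubspace_memI[OF V]
  have add: "m (x + v) = m x + m v" if x: "x \<in> V" and v: "v \<in> V" for x v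
  proof -
    \<comment> \<open>The infimum over \<open>t \<ge> 0\<close> lowers \<open>m\<close> in the
      direction \<open>v\<close> and stays sublinear. It is at most \<open>m\<close> because of
      \<open>t = 0\<close>, hence equals \<open>m\<close> by minimality; \<open>t = 1\<close> then
      gives \<open>m x + m v \<le> m (x + v)\<close>.\<close>
    let ?F = "\<lambda>t x. m (x + complex_of_real t *\<^sub>C v) - t * m v"
    have bd: "bdd_below ((\<lambda>t. ?F t x) ` {0..})" if x: "x \<in> V" for x
    proof (rule bdd_belowI2)
      fix t :: real assume t: "t \<in> {0..}"
      have "m (complex_of_real t *\<^sub>C v) \<le> m (x + complex_of_real t *\<^sub>C v) + m (- x)"
        using sublinear_on_add[OF m, of "x + complex_of_real t *\<^sub>C v" "- x"] x v Vm by simp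
      then show "- m (- x) \<le> ?F t x" using sublinear_on_scale[OF m V v] t by simp
    qed
    have sub: "sublinear_on V (\<lambda>x. INF t\<in>{0..}. ?F t x)"
    proof (rule sublinear_on_INF[OF _ bd _ _ V])
      fix s t :: real and x y assume *: "s \<in> {0..}" "t \<in> {0..}" "x \<in> V" "y \<in> V"
      have "x + y + complex_of_real (s + t) *\<^sub>C v = (x + complex_of_real s *\<^sub>C v) + (y + complex_of_real t *\<^sub>C v)"
        by (simp add: scaleC_add_left algebra_simps)
      then have "?F (s + t) (x + y) \<le> ?F s x + ?F t y"
        using sublinear_on_add[OF m, of "x + complex_of_real s *\<^sub>C v" "y + complex_of_real t *\<^sub>C v"] * v Vm
        by (simp add: algebra_simps)
      then show "\<exists>k\<in>{0..}. ?F k (x + y) \<le> ?F s x + ?F t y" using * by (intro bexI[of _ "s + t"]) auto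
    next
      fix s t :: real and x assume *: "0 < s" "t \<in> {0..}" "x \<in> V"
      have "complex_of_real s *\<^sub>C x + complex_of_real (s * t) *\<^sub>C v = complex_of_real s *\<^sub>C (x + complex_of_real t *\<^sub>C v)"
        by (simp add: scaleC_add_right scaleC_scaleC)
      then have "?F (s * t) (complex_of_real s *\<^sub>C x) \<le> s * ?F t x"
        using sublinear_on_scale[OF m V, of "x + complex_of_real t *\<^sub>C v" s] * v Vm by (simp add: algebra_simps)
      then show "\<exists>k\<in>{0..}. ?F k (complex_of_real s *\<^sub>C x) \<le> s * ?F t x"
        using * by (intro bexI[of _ "s * t"]) auto
    qed auto
    have le: "(INF t\<in>{0..}. ?F t x) \<le> ?F t x" if "x \<in> V" "t \<ge> 0" for x t
      using bd[OF that(1)] that(2) by (intro cINF_lower) auto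
    have "(INF t\<in>{0..}. ?F t x) = m x"
      using min[OF sub _ x] le[of _ 0] by simp
    then have "m x + m v \<le> m (x + v)" using le[OF x, of 1] by (simp add: scaleC_one)
    then show ?thesis using sublinear_on_add[OF m x v] by simp
  qed
  have neg: "m (- x) = - m x" if "x \<in> V" for x
    using add[OF that Vm(5)[OF that]] sublinear_on_0[OF m V] by simp
  have scale: "m (complex_of_real t *\<^sub>C x) = t * m x" if x: "x \<in> V" for t x
  proof (cases "t \<ge> 0")
    case True
    then show ?thesis using sublinear_on_scale[OF m V x] by simp
  next
    case False
    then have "m (complex_of_real (- t) *\<^sub>C x) = - t * m x" by (intro sublinear_on_scale[OF m V x]) simp
    moreover have "m (complex_of_real (- t) *\<^sub>C x) = - m (complex_of_real t *\<^sub>C x)"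
      using neg[OF Vm(3)[OF x]] by simp
    ultimately show ?thesis by simp
  qed
  show ?thesis using add scale mq by (intro exI[of _ m]) blast
qed

section \<open>Complex-linear maps and the complex Hahn-Banach theorem\<close>

lemma clinear_on_simps:
  assumes "clinear_on V T"
  shows "x \<in> V \<Longrightarrow> y \<in> V \<Longrightarrow> T (x + y) = T x + T y" "x \<in> V \<Longrightarrow> T (a *\<^sub>C x) = a *\<^sub>C T x"
  using assms by (auto simp: clinear_on_def)

lemma clinear_on_neg:
  assumes "clinear_on V T" and "x \<in> V"
  shows "T (- x) = - T x"
  using clinear_on_simps(2)[OF assms, of "-1"] by (simp add: scaleC_one)

lemma clinear_on_diff:
  assumes "clinear_on V T" and "csubspace V" and "x \<in> V" and "y \<in> V"
  shows "T (x - y) = T x - T y"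
  using clinear_on_simps(1)[OF assms(1,3), of "- y"] clinear_on_neg[OF assms(1,4)]
    csubspace_memI(5)[OF assms(2,4)] by simp

lemma clinear_on_0:
  assumes "clinear_on V T" and "csubspace V"
  shows "T 0 = 0"
  using clinear_on_diff[OF assms, of 0 0] csubspace_memI(1)[OF assms(2)] by simp

text \<open>Extending a functional along a linear map \<open>S\<close> rather than from a subspace avoids
  well-definedness arguments for functionals that are given on the range of \<open>S\<close>.\<close>

theorem hahn_banach:
  fixes V :: "'a::complex_vector set" and U :: "'b::complex_vector set"
  assumes V: "csubspace V" and U: "csubspace U"
    and S: "clinear_on U S" "S ` U \<subseteq> V" and h: "clinear_on U h"
    and p_add: "\<And>x y. x \<in> V \<Longrightarrow> y \<in> V \<Longrightarrow> p (x + y) \<le> p x + p y"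
    and p_scale: "\<And>a x. x \<in> V \<Longrightarrow> p (a *\<^sub>C x) = cmod a * p x"
    and h_le: "\<And>u. u \<in> U \<Longrightarrow> cmod (h u) \<le> p (S u)"
  shows "\<exists>F. clinear_on V F \<and> (\<forall>x\<in>V. cmod (F x) \<le> p x) \<and> (\<forall>u\<in>U. F (S u) = h u)"
proof -
  note Vm = csubspace_memI[OF V] and Um = csubspace_memI[OF U]
  have SV: "S u \<in> V" if "u \<in> U" for u using S that by blast
  have p_neg: "p (- x) = p x" if "x \<in> V" for x
    using p_scale[OF that, of "-1"] by (simp add: scaleC_one)
  \<comment> \<open>The infimum \<open>?q\<close> encodes both constraints: \<open>u = 0\<close>
    shows \<open>?q \<le> p\<close>, and \<open>x = S u\<close> shows
    \<open>?q (S u) \<le> Re (h u)\<close>. A real-linear functional below \<open>?q\<close> must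
    agree with \<open>Re (h u)\<close> at \<open>S u\<close>, by applying the second bound to
    \<open>u\<close> and to \<open>- u\<close>.\<close>
  let ?F = "\<lambda>u x. p (x - S u) + Re (h u)"
  let ?q = "\<lambda>x. INF u\<in>U. ?F u x"
  have bd: "bdd_below ((\<lambda>u. ?F u x) ` U)" if x: "x \<in> V" for x
  proof (rule bdd_belowI2)
    fix u assume u: "u \<in> U"
    have "p (S u) \<le> p (x - (x - S u))" by simp
    also have "\<dots> \<le> p x + p (x - S u)"
      using p_add[of x "- (x - S u)"] p_neg[of "x - S u"] x SV[OF u] Vm by simp
    finally have "p (S u) \<le> p x + p (x - S u)" .
    moreover have "- Re (h u) \<le> p (S u)" using h_le[OF u] abs_Re_le_cmod[of "h u"] by linarith
    ultimately show "- p x \<le> ?F u x" by simp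
  qed
  have q: "sublinear_on V ?q"
  proof (rule sublinear_on_INF[OF _ bd _ _ V])
    show "U \<noteq> {}" using Um by blast
    fix u v x y assume *: "u \<in> U" "v \<in> U" "x \<in> V" "y \<in> V"
    have "?F (u + v) (x + y) \<le> ?F u x + ?F v y"
      using p_add[of "x - S u" "y - S v"] * SV Vm
      by (simp add: clinear_on_simps[OF S(1)] clinear_on_simps[OF h] algebra_simps)
    then show "\<exists>k\<in>U. ?F k (x + y) \<le> ?F u x + ?F v y" using * Um by blast
  next
    fix t :: real and u x assume *: "t > 0" "u \<in> U" "x \<in> V"
    have "complex_of_real t *\<^sub>C (x - S u) = complex_of_real t *\<^sub>C x - complex_of_real t *\<^sub>C S u"
      by (rule complex_vector.scale_right_diff_distrib)
    then have "?F (complex_of_real t *\<^sub>C u) (complex_of_real t *\<^sub>C x) \<le> t * ?F u x"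
      using p_scale[of "x - S u" "complex_of_real t"] * SV Vm
      by (simp add: clinear_on_simps[OF S(1)] clinear_on_simps[OF h] scaleC_complex_def algebra_simps)
    then show "\<exists>k\<in>U. ?F k (complex_of_real t *\<^sub>C x) \<le> t * ?F u x" using * Um by blast
  qed
  obtain F where F: "\<And>x y. x \<in> V \<Longrightarrow> y \<in> V \<Longrightarrow> F (x + y) = F x + F y"
    "\<And>t x. x \<in> V \<Longrightarrow> F (complex_of_real t *\<^sub>C x) = t * F x" "\<And>x. x \<in> V \<Longrightarrow> F x \<le> ?q x"
    using exists_linear_below_sublinear[OF q V] by blast
  have p0: "p 0 = 0" using p_scale[OF Vm(1), of 0] by simp
  have Fle: "F x \<le> ?F u x" if "x \<in> V" "u \<in> U" for x u
    using F(3)[OF that(1)] cINF_lower[OF bd[OF that(1)] that(2)] by simp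
  have Fneg: "F (- x) = - F x" if "x \<in> V" for x
    using F(2)[OF that, of "-1"] by (simp add: scaleC_one)
  have FS: "F (S u) = Re (h u)" if u: "u \<in> U" for u
  proof -
    have "F (- S u) \<le> ?F (- u) (- S u)" by (rule Fle[OF Vm(5)[OF SV[OF u]] Um(5)[OF u]])
    then have "- F (S u) \<le> - Re (h u)"
      using p0 Fneg[OF SV[OF u]] clinear_on_neg[OF S(1) u] clinear_on_neg[OF h u] by simp
    moreover have "F (S u) \<le> Re (h u)" using Fle[OF SV[OF u] u] p0 by simp
    ultimately show ?thesis by simp
  qed
  \<comment> \<open>The only complex-linear functional with real part \<open>F\<close>: its
    imaginary part at \<open>x\<close> is forced to be
    \<open>- F (\<i> *\<^sub>C x)\<close>.\<close>
  define G where "G x = Complex (F x) (- F (\<i> *\<^sub>C x))" for x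
  have Gadd: "G (x + y) = G x + G y" if "x \<in> V" "y \<in> V" for x y
    using that Vm by (simp add: G_def complex_eq_iff F scaleC_add_right)
  have Gscale: "G (a *\<^sub>C x) = a * G x" if x: "x \<in> V" for a x
  proof -
    have 1: "a *\<^sub>C x = complex_of_real (Re a) *\<^sub>C x + complex_of_real (Im a) *\<^sub>C \<i> *\<^sub>C x"
      by (simp add: scaleC_scaleC flip: scaleC_add_left) (simp add: complex_eq mult.commute)
    have 2: "\<i> *\<^sub>C a *\<^sub>C x = complex_of_real (Re a) *\<^sub>C \<i> *\<^sub>C x + complex_of_real (- Im a) *\<^sub>C x"
    proof -
      have "\<i> * a = complex_of_real (Re a) * \<i> + complex_of_real (- Im a)"
        by (simp add: complex_eq_iff)
      then show ?thesis unfolding scaleC_scaleC by (metis scaleC_add_left)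
    qed
    show ?thesis unfolding G_def 2 unfolding 1 using x Vm by (simp add: complex_eq_iff F del: of_real_minus complex_vector.scale_scale)
  qed
  have Gle: "cmod (G x) \<le> p x" if x: "x \<in> V" for x
  proof -
    \<comment> \<open>A rotation making \<open>a * G x\<close> real and nonnegative, so that the
      bound on the real part \<open>F\<close> at \<open>a *\<^sub>C x\<close> controls the modulus
      without a loss of constant.\<close>
    obtain a where a: "cmod a = 1" "a * G x = cmod (G x)"
    proof (cases "G x = 0")
      case True
      then show ?thesis using that[of 1] by simp
    next
      case False
      then show ?thesis using that[of "cmod (G x) / G x"] by (simp add: norm_divide)
    qed
    have "F (a *\<^sub>C x) \<le> p (a *\<^sub>C x)"
      using Fle[OF Vm(3)[OF x] Um(1), of a] clinear_on_0[OF S(1) U] clinear_on_0[OF h U] by simp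
    then have "F (a *\<^sub>C x) \<le> p x" using p_scale[OF x, of a] a(1) by simp
    moreover have "F (a *\<^sub>C x) = Re (a * G x)" unfolding Gscale[OF x, symmetric] by (simp add: G_def)
    ultimately show ?thesis using a by simp
  qed
  have GS: "G (S u) = h u" if u: "u \<in> U" for u
    using FS[OF u] FS[OF Um(3)[OF u, of \<i>]] clinear_on_simps(2)[OF S(1) u, of \<i>]
      clinear_on_simps(2)[OF h u, of \<i>]
    by (simp add: G_def complex_eq_iff scaleC_complex_def)
  show ?thesis
    using Gadd Gscale Gle GS by (intro exI[of _ G]) (simp add: clinear_on_def scaleC_complex_def)
qed

section \<open>Sequence spaces\<close>

lemma conj_exp_gt_1: "1 < p \<Longrightarrow> 1 < conj_exp p"
  by (simp add: conj_exp_def)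

lemma norm_s_nonneg: "0 \<le> norm_s p y"
  by (simp add: norm_s_def)

lemma norm_s_powr:
  assumes "y \<in> ell_s p" and "1 < p"
  shows "norm_s p y powr p = (\<Sum>n. norm (y n) powr p)"
  using assms suminf_nonneg[of "\<lambda>n. norm (y n) powr p"] by (simp add: norm_s_def powr_powr ell_s_def)

lemma sum_le_norm_s_powr:
  assumes "y \<in> ell_s p" and "1 < p" and "finite K"
  shows "(\<Sum>n\<in>K. norm (y n) powr p) \<le> norm_s p y powr p"
  unfolding norm_s_powr[OF assms(1,2)] using assms by (intro sum_le_suminf) (auto simp: ell_s_def)

lemma ell_s_boundI:
  assumes p: "1 < p" and c: "0 \<le> c" and le: "\<And>m. (\<Sum>n<m. norm (y n) powr p) \<le> c powr p"
  shows "y \<in> ell_s p" and "norm_s p y \<le> c"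
proof -
  have s: "summable (\<lambda>n. norm (y n) powr p)"
    by (rule summableI_nonneg_bounded[OF _ le]) simp
  then show "y \<in> ell_s p" by (simp add: ell_s_def)
  have "(\<Sum>n. norm (y n) powr p) \<le> c powr p" by (rule suminf_le_const[OF s le])
  then have "(\<Sum>n. norm (y n) powr p) powr (1/p) \<le> (c powr p) powr (1/p)"
    using p suminf_nonneg[OF s] by (intro powr_mono2) auto
  then show "norm_s p y \<le> c" using p c by (simp add: norm_s_def powr_powr)
qed

lemma ell_s_scale:
  fixes y :: "nat \<Rightarrow> 'a::complex_normed_vector"
  assumes "y \<in> ell_s p" and "1 < p"
  shows "(\<lambda>n. a *\<^sub>C y n) \<in> ell_s p" and "norm_s p (\<lambda>n. a *\<^sub>C y n) = cmod a * norm_s p y"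
proof -
  have eq: "norm (a *\<^sub>C y n) powr p = cmod a powr p * norm (y n) powr p" for n
    by (simp add: norm_scaleC powr_mult)
  have s: "summable (\<lambda>n. norm (y n) powr p)" using assms by (simp add: ell_s_def)
  then show "(\<lambda>n. a *\<^sub>C y n) \<in> ell_s p" by (simp add: ell_s_def eq summable_mult)
  show "norm_s p (\<lambda>n. a *\<^sub>C y n) = cmod a * norm_s p y"
    using assms suminf_nonneg[OF s] by (simp add: norm_s_def eq suminf_mult[OF s] powr_mult powr_powr)
qed

section \<open>Finite Hoelder and Minkowski inequalities\<close>

lemma sum_powr_le_0D:
  fixes c :: "'i \<Rightarrow> real"
  assumes "finite K" and "(\<Sum>i\<in>K. c i powr r) \<le> 0" and "i \<in> K"
  shows "c i = 0"
proof -
  have "(\<Sum>i\<in>K. c i powr r) = 0" using assms by (intro antisym sum_nonneg) auto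
  then show ?thesis using assms by (simp add: sum_nonneg_eq_0_iff)
qed

text \<open>Young's inequality is summed over the quotients \<open>a i / A\<close> and
  \<open>b i / B\<close>, with total \<open>1 / p + 1 / conj_exp p = 1\<close>; if \<open>A\<close>
  or \<open>B\<close> is 0, all products vanish. Taking upper bounds \<open>A\<close>,
  \<open>B\<close> instead of the exact norms lets finite sums be compared directly with norms of
  infinite sequences.\<close>

lemma holder_sum:
  fixes a b :: "'i \<Rightarrow> real"
  assumes pq: "1 < p" and K: "finite K" and AB: "0 \<le> A" "0 \<le> B"
    and ab: "\<And>i. i \<in> K \<Longrightarrow> 0 \<le> a i" "\<And>i. i \<in> K \<Longrightarrow> 0 \<le> b i"
    and le: "(\<Sum>i\<in>K. a i powr p) \<le> A powr p" "(\<Sum>i\<in>K. b i powr conj_exp p) \<le> B powr conj_exp p"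
  shows "(\<Sum>i\<in>K. a i * b i) \<le> A * B"
proof (cases "A = 0 \<or> B = 0")
  case True
  note zero = sum_powr_le_0D[OF K]
  have "a i * b i = 0" if "i \<in> K" for i
    using True le zero[of a p i] zero[of b "conj_exp p" i] that by auto
  then have "(\<Sum>i\<in>K. a i * b i) = 0" by (rule sum.neutral[OF ballI])
  then show ?thesis using AB by simp
next
  case False
  then have pos: "A > 0" "B > 0" using AB by auto
  let ?q = "conj_exp p"
  have q: "1 < ?q" using conj_exp_gt_1[OF pq] .
  have "a i / A * (b i / B) \<le> (a i powr p / A powr p) / p + (b i powr ?q / B powr ?q) / ?q" if "i \<in> K" for i
    using Youngs_inequality[of p ?q "a i / A" "b i / B"] pq q conj_exp[OF pq] ab[OF that] pos
    by (simp add: powr_divide)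
  then have "(\<Sum>i\<in>K. a i / A * (b i / B)) \<le>
      (\<Sum>i\<in>K. (a i powr p / A powr p) / p + (b i powr ?q / B powr ?q) / ?q)"
    by (rule sum_mono)
  also have "\<dots> = ((\<Sum>i\<in>K. a i powr p) / A powr p) / p + ((\<Sum>i\<in>K. b i powr ?q) / B powr ?q) / ?q"
    by (simp add: sum.distrib sum_divide_distrib)
  also have "\<dots> \<le> 1 / p + 1 / ?q"
    using le pos pq q by (intro add_mono divide_right_mono) auto
  finally have "(\<Sum>i\<in>K. a i / A * (b i / B)) \<le> 1" using conj_exp[OF pq] by simp
  moreover have "(\<Sum>i\<in>K. a i / A * (b i / B)) = (\<Sum>i\<in>K. a i * b i) / (A * B)"
    by (simp add: sum_divide_distrib)
  ultimately show ?thesis using pos by (simp add: pos_divide_le_eq)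
qed

text \<open>For positive \<open>s\<close> and \<open>t\<close> this is convexity of the power. At
  the boundary it reduces to \<open>w powr p \<le> w\<close> for
  \<open>0 < w \<le> 1\<close>.\<close>

lemma powr_convex_combination:
  fixes s t u v p :: real
  assumes "1 \<le> p" "0 \<le> s" "0 \<le> t" "0 < u" "0 < v" "u + v = 1"
  shows "(u * s + v * t) powr p \<le> u * s powr p + v * t powr p"
proof -
  have small: "(w * r) powr p \<le> w * r powr p" if "0 < w" "w \<le> 1" "0 \<le> r" for w r :: real
  proof -
    have "w powr p \<le> w powr 1" using that assms by (intro powr_mono') auto
    then show ?thesis using that by (simp add: powr_mult mult_right_mono)
  qed
  consider "s = 0" | "t = 0" | "s > 0" "t > 0" using assms by linarith
  then show ?thesis
  proof cases
    case 1
    then show ?thesis using small[of v t] assms by simp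
  next
    case 2
    then show ?thesis using small[of u s] assms by simp
  next
    case 3
    then show ?thesis
      using convex_onD[OF powr_convex[OF assms(1)], of v s t] assms by (simp add: eq_diff_eq[symmetric])
  qed
qed

text \<open>The quotient \<open>(a i + b i) / (A + B)\<close> is the convex combination of
  \<open>a i / A\<close> and \<open>b i / B\<close> with weights \<open>A / (A + B)\<close> and
  \<open>B / (A + B)\<close>. Convexity of the power is applied termwise and summed.\<close>

lemma minkowski_sum:
  fixes a b :: "'i \<Rightarrow> real"
  assumes p: "1 < p" and K: "finite K" and AB: "0 \<le> A" "0 \<le> B"
    and ab: "\<And>i. i \<in> K \<Longrightarrow> 0 \<le> a i" "\<And>i. i \<in> K \<Longrightarrow> 0 \<le> b i"
    and le: "(\<Sum>i\<in>K. a i powr p) \<le> A powr p" "(\<Sum>i\<in>K. b i powr p) \<le> B powr p"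
  shows "(\<Sum>i\<in>K. (a i + b i) powr p) \<le> (A + B) powr p"
proof -
  note zero = sum_powr_le_0D[OF K]
  consider "A = 0" | "B = 0" | "A > 0" "B > 0" using AB by linarith
  then show ?thesis
  proof cases
    case 1
    then show ?thesis using le zero[of a p] by simp
  next
    case 2
    then show ?thesis using le zero[of b p] by simp
  next
    case 3
    let ?u = "A / (A + B)" and ?v = "B / (A + B)"
    have "(a i + b i) powr p \<le> (A + B) powr p * (?u * (a i powr p / A powr p) + ?v * (b i powr p / B powr p))"
      if "i \<in> K" for i
    proof -
      have "?u + ?v = 1" using 3 by (simp add: add_divide_distrib[symmetric])
      then have "(?u * (a i / A) + ?v * (b i / B)) powr p \<le> ?u * (a i / A) powr p + ?v * (b i / B) powr p"
        using 3 p ab[OF that] by (intro powr_convex_combination) auto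
      moreover have "?u * (a i / A) + ?v * (b i / B) = (a i + b i) / (A + B)"
        using 3 by (simp add: add_divide_distrib)
      ultimately have "(a i + b i) powr p / (A + B) powr p
          \<le> ?u * (a i powr p / A powr p) + ?v * (b i powr p / B powr p)"
        using 3 ab[OF that] by (simp add: powr_divide)
      then show ?thesis using 3 by (simp add: pos_divide_le_eq mult.commute)
    qed
    then have "(\<Sum>i\<in>K. (a i + b i) powr p) \<le>
        (\<Sum>i\<in>K. (A + B) powr p * (?u * (a i powr p / A powr p) + ?v * (b i powr p / B powr p)))"
      by (rule sum_mono)
    also have "\<dots> = (A + B) powr p * (?u * ((\<Sum>i\<in>K. a i powr p) / A powr p) + ?v * ((\<Sum>i\<in>K. b i powr p) / B powr p))"
      unfolding sum_divide_distrib sum_distrib_left sum.distrib[symmetric] ..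
    also have "\<dots> \<le> (A + B) powr p * (?u * 1 + ?v * 1)"
      using le 3 by (intro mult_left_mono add_mono) auto
    also have "?u * 1 + ?v * 1 = 1" using 3 by (simp add: add_divide_distrib[symmetric])
    finally show ?thesis by simp
  qed
qed

lemma ell_s_add:
  fixes x y :: "nat \<Rightarrow> 'a::complex_normed_vector"
  assumes xy: "x \<in> ell_s p" "y \<in> ell_s p" and p: "1 < p"
  shows "(\<lambda>n. x n + y n) \<in> ell_s p" and "norm_s p (\<lambda>n. x n + y n) \<le> norm_s p x + norm_s p y"
proof -
  have "(\<Sum>n<m. norm (x n + y n) powr p) \<le> (norm_s p x + norm_s p y) powr p" for m
  proof -
    have "(\<Sum>n<m. norm (x n + y n) powr p) \<le> (\<Sum>n<m. (norm (x n) + norm (y n)) powr p)"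
      using p by (intro sum_mono powr_mono2 norm_triangle_ineq) auto
    also have "\<dots> \<le> (norm_s p x + norm_s p y) powr p"
      using sum_le_norm_s_powr[OF xy(1) p] sum_le_norm_s_powr[OF xy(2) p]
      by (intro minkowski_sum[OF p]) (auto simp: norm_s_nonneg)
    finally show ?thesis .
  qed
  from ell_s_boundI[OF p _ this] show "(\<lambda>n. x n + y n) \<in> ell_s p"
    "norm_s p (\<lambda>n. x n + y n) \<le> norm_s p x + norm_s p y"
    by (simp_all add: norm_s_nonneg)
qed

lemma csubspace_ell_s: "1 < p \<Longrightarrow> csubspace (ell_s p :: (nat \<Rightarrow> 'a::complex_normed_vector) set)"
  unfolding complex_vector.subspace_def
  by (auto simp: plus_fun_def scaleC_fun_def ell_s_add ell_s_scale) (simp add: ell_s_def)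

lemma holder_ell_s:
  assumes p: "1 < p" and x: "x \<in> ell_s p" and \<alpha>: "\<alpha> \<in> ell_s (conj_exp p)"
  shows "summable (\<lambda>n. \<alpha> n * x n :: complex)" and "cmod (\<Sum>n. \<alpha> n * x n) \<le> norm_s (conj_exp p) \<alpha> * norm_s p x"
proof -
  have le: "(\<Sum>n<m. cmod (\<alpha> n * x n)) \<le> norm_s (conj_exp p) \<alpha> * norm_s p x" for m
    using holder_sum[OF p, of "{..<m}" "norm_s p x" "norm_s (conj_exp p) \<alpha>" "\<lambda>n. cmod (x n)" "\<lambda>n. cmod (\<alpha> n)"]
      sum_le_norm_s_powr[OF x p] sum_le_norm_s_powr[OF \<alpha> conj_exp_gt_1[OF p]]
    by (simp add: norm_s_nonneg norm_mult mult.commute)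
  have s: "summable (\<lambda>n. cmod (\<alpha> n * x n))"
    by (rule summableI_nonneg_bounded[OF _ le]) simp
  then show "summable (\<lambda>n. \<alpha> n * x n)" by (rule summable_norm_cancel)
  show "cmod (\<Sum>n. \<alpha> n * x n) \<le> norm_s (conj_exp p) \<alpha> * norm_s p x"
    using summable_norm[OF s] suminf_le_const[OF s le] by (rule order_trans)
qed

section \<open>The dual of ell_p\<close>

lemma clinear_on_ell_s_truncate:
  fixes f :: "(nat \<Rightarrow> complex) \<Rightarrow> complex"
  assumes p: "1 < p" and f: "clinear_on (ell_s p) f"
  shows "(\<lambda>k. if k < m then x k else 0) \<in> ell_s p"
    and "f (\<lambda>k. if k < m then x k else 0) = (\<Sum>n<m. x n * f (\<lambda>k. if k = n then 1 else 0))"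
proof -
  note V = csubspace_ell_s[OF p, where 'a = complex]
  let ?e = "\<lambda>n k. if k = n then 1 else 0 :: complex"
  let ?t = "\<lambda>m k. if k < m then x k else 0"
  have e: "?e n \<in> ell_s p" for n
    by (auto simp: ell_s_def intro!: summable_finite[of "{n}"] split: if_splits)
  have step: "?t (Suc m) = ?t m + x m *\<^sub>C ?e m" for m
    by (auto simp: fun_eq_iff plus_fun_def scaleC_fun_def scaleC_complex_def less_Suc_eq)
  have t: "?t m \<in> ell_s p" for m
    by (auto simp: ell_s_def intro!: summable_finite[of "{..<m}"] split: if_splits)
  then show "?t m \<in> ell_s p" .
  show "f (?t m) = (\<Sum>n<m. x n * f (?e n))"
  proof (induction m)
    case 0
    have "?t 0 = 0" by (simp add: zero_fun_def)
    then show ?case using clinear_on_0[OF f V] by simp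
  next
    case (Suc m)
    have "f (?t (Suc m)) = f (?t m) + x m *\<^sub>C f (?e m)"
      unfolding step using clinear_on_simps[OF f] t e csubspace_memI(3)[OF V e] by simp
    then show ?case using Suc by (simp add: scaleC_complex_def)
  qed
qed

text \<open>Cancelling \<open>S powr (1 / p)\<close> leaves
  \<open>S powr (1 / conj_exp p) \<le> c\<close>, because the two exponents add up to 1. This turns
  the estimate of a functional on a test vector into a bound for its coefficients.\<close>

lemma le_powr_conj_exp:
  assumes p: "1 < p" and S: "0 \<le> S" and c: "0 \<le> c" and le: "S \<le> c * S powr (1 / p)"
  shows "S \<le> c powr conj_exp p"
proof (cases "S = 0")
  case False
  then have "S > 0" using S by simp
  have q: "1 < conj_exp p" using conj_exp_gt_1[OF p] .
  have "S powr (1 / conj_exp p) * S powr (1 / p) = S"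
    using conj_exp[OF p] \<open>S > 0\<close> by (simp add: powr_add[symmetric] add.commute)
  then have "S powr (1 / conj_exp p) * S powr (1 / p) \<le> c * S powr (1 / p)" using le by simp
  then have "S powr (1 / conj_exp p) \<le> c" using \<open>S > 0\<close> by simp
  then have "(S powr (1 / conj_exp p)) powr conj_exp p \<le> c powr conj_exp p"
    using q by (intro powr_mono2) auto
  then show ?thesis using q \<open>S > 0\<close> by (simp add: powr_powr)
qed simp

text \<open>The coefficients are the values of \<open>f\<close> at the unit vectors. Testing
  \<open>f\<close> on truncations of the extremal vector of Hoelder's inequality bounds their q-norm
  by \<open>c\<close>; convergence of the series to \<open>f x\<close> follows since the truncations
  of \<open>x\<close> tend to \<open>x\<close> in norm.\<close>

theorem ell_s_dual_representation:
  fixes f :: "(nat \<Rightarrow> complex) \<Rightarrow> complex"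
  assumes p: "1 < p" and f: "clinear_on (ell_s p) f" and c: "0 \<le> c"
    and f_le: "\<And>x. x \<in> ell_s p \<Longrightarrow> cmod (f x) \<le> c * norm_s p x"
  shows "\<exists>\<alpha>\<in>ell_s (conj_exp p). norm_s (conj_exp p) \<alpha> \<le> c \<and> (\<forall>x\<in>ell_s p. (\<lambda>n. \<alpha> n * x n) sums f x)"
proof -
  let ?q = "conj_exp p"
  note V = csubspace_ell_s[OF p, where 'a = complex]
  have q: "1 < ?q" using conj_exp_gt_1[OF p] .
  define \<alpha> where "\<alpha> n = f (\<lambda>k. if k = n then 1 else 0)" for n :: nat
  note trunc = clinear_on_ell_s_truncate[OF p f, folded \<alpha>_def]
  have "(\<Sum>n<m. cmod (\<alpha> n) powr ?q) \<le> c powr ?q" for m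
  proof -
    let ?S = "\<Sum>n<m. cmod (\<alpha> n) powr ?q"
    \<comment> \<open>The equality case of Hoelder's inequality: \<open>x n * \<alpha> n\<close> and
      the p-th power of \<open>cmod (x n)\<close> are both the power \<open>?q\<close> of
      \<open>cmod (\<alpha> n)\<close>. The exponent is \<open>?q - 2\<close> because the conjugate
      contributes one more factor of the modulus, and \<open>(?q - 1) * p = ?q\<close>.\<close>
    define x where "x n = cnj (\<alpha> n) * complex_of_real (cmod (\<alpha> n) powr (?q - 2))" for n
    have x\<alpha>: "x n * \<alpha> n = complex_of_real (cmod (\<alpha> n) powr ?q)" for n
    proof (cases "\<alpha> n = 0")
      case False
      have "x n * \<alpha> n = (\<alpha> n * cnj (\<alpha> n)) * complex_of_real (cmod (\<alpha> n) powr (?q - 2))"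
        by (simp add: x_def mult_ac)
      also have "\<dots> = complex_of_real ((cmod (\<alpha> n))\<^sup>2 * cmod (\<alpha> n) powr (?q - 2))"
        by (simp only: complex_norm_square of_real_mult)
      also have "(cmod (\<alpha> n))\<^sup>2 * cmod (\<alpha> n) powr (?q - 2) = cmod (\<alpha> n) powr ?q"
        using False by (simp add: powr_diff)
      finally show ?thesis .
    qed (simp add: x_def)
    have norm_x: "cmod (x n) powr p = cmod (\<alpha> n) powr ?q" for n
    proof (cases "\<alpha> n = 0")
      case False
      have "cmod (x n) = cmod (\<alpha> n) powr 1 * cmod (\<alpha> n) powr (?q - 2)"
        using False by (simp add: x_def norm_mult)
      also have "\<dots> = cmod (\<alpha> n) powr (?q - 1)" unfolding powr_add[symmetric] by simp
      finally have "cmod (x n) powr p = cmod (\<alpha> n) powr ((?q - 1) * p)" by (simp add: powr_powr)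
      also have "(?q - 1) * p = ?q" using p by (simp add: conj_exp_def field_simps)
      finally show ?thesis .
    qed (simp add: x_def)
    let ?x = "\<lambda>k. if k < m then x k else 0"
    have "(\<lambda>k. cmod (?x k) powr p) sums (\<Sum>k<m. cmod (?x k) powr p)"
      by (rule sums_finite) auto
    from sums_unique[OF this] have norm: "norm_s p ?x = ?S powr (1 / p)"
      by (simp add: norm_s_def norm_x)
    have "f ?x = complex_of_real ?S" using trunc(2)[of m x] x\<alpha> by simp
    then have "?S \<le> c * ?S powr (1 / p)"
      using f_le[OF trunc(1)[of m x]] norm by (simp add: sum_nonneg del: of_real_sum)
    then show ?thesis by (intro le_powr_conj_exp[OF p]) (auto simp: c sum_nonneg)
  qed
  from ell_s_boundI[OF q c this] have \<alpha>: "\<alpha> \<in> ell_s ?q" "norm_s ?q \<alpha> \<le> c" .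
  moreover have "(\<lambda>n. \<alpha> n * x n) sums f x" if x: "x \<in> ell_s p" for x
  proof -
    let ?t = "\<lambda>m k. if k < m then x k else 0"
    let ?r = "\<lambda>m. (\<Sum>n. cmod (x n) powr p) - (\<Sum>n<m. cmod (x n) powr p)"
    have s: "summable (\<lambda>n. cmod (x n) powr p)" using x by (simp add: ell_s_def)
    have tail: "norm_s p (x - ?t m) = ?r m powr (1 / p)" for m
    proof -
      have "(\<lambda>k. cmod (x k) powr p - cmod (?t m k) powr p) sums ((\<Sum>n. cmod (x n) powr p) - (\<Sum>k<m. cmod (?t m k) powr p))"
        by (intro sums_diff summable_sums s sums_finite) auto
      moreover have "cmod (x k) powr p - cmod (?t m k) powr p = cmod ((x - ?t m) k) powr p" for k
        by (simp add: fun_diff_def)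
      ultimately have "(\<lambda>k. cmod ((x - ?t m) k) powr p) sums ?r m" by simp
      from sums_unique[OF this] show ?thesis unfolding norm_s_def by (simp only:)
    qed
    have "?r \<longlonglongrightarrow> (\<Sum>n. cmod (x n) powr p) - (\<Sum>n. cmod (x n) powr p)"
      by (intro tendsto_intros summable_LIMSEQ s)
    then have "?r \<longlonglongrightarrow> 0" by simp
    then have "(\<lambda>m. ?r m powr (1 / p)) \<longlonglongrightarrow> 0"
      using p sum_le_suminf[OF s] by (intro tendsto_zero_powrI[where b = "1/p"]) auto
    then have lim: "(\<lambda>m. c * ?r m powr (1 / p)) \<longlonglongrightarrow> 0" by (rule tendsto_mult_right_zero)
    have "cmod (f x - (\<Sum>n<m. \<alpha> n * x n)) \<le> c * ?r m powr (1 / p)" for m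
    proof -
      have "f x - (\<Sum>n<m. \<alpha> n * x n) = f (x - ?t m)"
        using clinear_on_diff[OF f V x trunc(1)[of m x]] trunc(2)[of m x] by (simp add: mult.commute)
      then show ?thesis
        using f_le[OF csubspace_memI(4)[OF V x trunc(1)[of m x]]] tail[of m] by simp
    qed
    then have "(\<lambda>m. f x - (\<Sum>n<m. \<alpha> n * x n)) \<longlonglongrightarrow> 0"
      by (intro Lim_null_comparison[OF _ lim]) auto
    then have "(\<lambda>m. f x - (f x - (\<Sum>n<m. \<alpha> n * x n))) \<longlonglongrightarrow> f x - 0"
      by (intro tendsto_diff tendsto_const)
    then show ?thesis by (simp add: sums_def)
  qed
  ultimately show ?thesis by blast
qed

section \<open>Duals and second adjoints\<close>

lemma complex_normed_space_on_UNIV: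
  "complex_normed_space_on (UNIV :: 'a::complex_normed_vector set) norm"
  by unfold_locales (auto simp: complex_vector.subspace_def norm_triangle_ineq norm_scaleC)

lemma complex_normed_space_on_subset:
  assumes "complex_normed_space_on V N" and "csubspace W" and "W \<subseteq> V"
  shows "complex_normed_space_on W N"
proof -
  interpret complex_normed_space_on V N by fact
  show ?thesis
    using assms(2,3) by unfold_locales (auto simp: nonneg eq_zero_iff triangle homogeneous subset_iff)
qed

lemma bdd_above_op_norm:
  assumes "complex_normed_space_on V N" and T: "T \<in> bounded_ops V N W M"
  shows "bdd_above ((\<lambda>x. M (T x)) ` {x\<in>V. N x \<le> 1})"
proof -
  interpret complex_normed_space_on V N by fact
  obtain C where C: "\<And>x. x \<in> V \<Longrightarrow> M (T x) \<le> C * N x" using T by (auto simp: bounded_ops_def)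
  show ?thesis
  proof (rule bdd_aboveI2)
    fix x assume x: "x \<in> {x\<in>V. N x \<le> 1}"
    have "M (T x) \<le> C * N x" using C x by simp
    \<comment> \<open>The constant in \<open>bounded_ops\<close> carries no sign condition, hence
      the absolute value.\<close>
    also have "\<dots> \<le> \<bar>C\<bar> * N x" using nonneg[of x] x by (intro mult_right_mono) auto
    also have "\<dots> \<le> \<bar>C\<bar> * 1" using x by (intro mult_left_mono) auto
    finally show "M (T x) \<le> \<bar>C\<bar> * 1" .
  qed
qed

lemma op_norm_bound:
  assumes VN: "complex_normed_space_on V N" and WM: "complex_normed_space_on W M"
    and T: "T \<in> bounded_ops V N W M" and x: "x \<in> V"
  shows "M (T x) \<le> op_norm V N M T * N x"
proof -
  interpret V: complex_normed_space_on V N by fact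
  interpret W: complex_normed_space_on W M by fact
  have lin: "clinear_on V T" and TW: "T x \<in> W" using T x by (auto simp: bounded_ops_def)
  show ?thesis
  proof (cases "x = 0")
    case True
    have "M 0 = 0" using W.eq_zero_iff[OF csubspace_memI(1)[OF W.csubspace]] by simp
    then show ?thesis
      using True clinear_on_0[OF lin V.csubspace] V.eq_zero_iff[OF x] by simp
  next
    case False
    then have pos: "N x > 0" using V.nonneg[OF x] V.eq_zero_iff[OF x] by linarith
    let ?a = "complex_of_real (inverse (N x))"
    have a: "cmod ?a = inverse (N x)" unfolding norm_of_real using pos by simp
    have "M (T (?a *\<^sub>C x)) \<le> op_norm V N M T"
      unfolding op_norm_def
    proof (rule cSUP_upper[OF _ bdd_above_op_norm[OF VN T]])
      show "?a *\<^sub>C x \<in> {x \<in> V. N x \<le> 1}"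
        using V.homogeneous[OF x, of ?a] csubspace_memI(3)[OF V.csubspace x] a pos by simp
    qed
    moreover have "M (T (?a *\<^sub>C x)) = inverse (N x) * M (T x)"
      unfolding clinear_on_simps(2)[OF lin x] W.homogeneous[OF TW] a ..
    ultimately have "inverse (N x) * M (T x) \<le> op_norm V N M T" by simp
    then show ?thesis using pos by (simp add: field_simps)
  qed
qed

lemma op_norm_leI:
  assumes "complex_normed_space_on V N" and "0 \<le> c" and "\<And>x. x \<in> V \<Longrightarrow> M (T x) \<le> c * N x"
  shows "op_norm V N M T \<le> c"
proof -
  interpret complex_normed_space_on V N by fact
  have "0 \<in> V" "N 0 = 0" using csubspace_memI(1)[OF csubspace] eq_zero_iff by auto
  then have ne: "{x\<in>V. N x \<le> 1} \<noteq> {}" by force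
  show ?thesis
    unfolding op_norm_def
  proof (rule cSUP_least[OF ne])
    fix x assume x: "x \<in> {x\<in>V. N x \<le> 1}"
    have "M (T x) \<le> c * N x" using assms(3) x by simp
    also have "\<dots> \<le> c * 1" using x assms(2) by (intro mult_left_mono) auto
    finally show "M (T x) \<le> c" by simp
  qed
qed

lemma op_norm_nonneg:
  assumes VN: "complex_normed_space_on V N" and WM: "complex_normed_space_on W M"
    and T: "T \<in> bounded_ops V N W M"
  shows "0 \<le> op_norm V N M T"
proof -
  interpret V: complex_normed_space_on V N by fact
  interpret W: complex_normed_space_on W M by fact
  have 0: "0 \<in> V" "N 0 = 0" using csubspace_memI(1)[OF V.csubspace] V.eq_zero_iff by auto
  then have "T 0 \<in> W" using T by (auto simp: bounded_ops_def)
  then have "0 \<le> M (T 0)" by (rule W.nonneg)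
  also have "\<dots> \<le> op_norm V N M T"
    unfolding op_norm_def using 0 by (intro cSUP_upper bdd_above_op_norm[OF VN T] CollectI conjI) simp_all
  finally show ?thesis .
qed

lemma dualI:
  assumes "clinear_on V f" and "\<And>x. x \<in> V \<Longrightarrow> cmod (f x) \<le> c * N x" and "\<And>x. x \<notin> V \<Longrightarrow> f x = 0"
  shows "f \<in> dual V N"
  using assms by (auto simp: dual_def bounded_ops_def)

lemma dual_clinear: "f \<in> dual V N \<Longrightarrow> clinear_on V f"
  by (simp add: dual_def bounded_ops_def)

lemma dual_bound:
  assumes "complex_normed_space_on V N" and "f \<in> dual V N" and "x \<in> V"
  shows "cmod (f x) \<le> dual_norm V N f * N x"
  unfolding dual_norm_def using assms(2)
  by (intro op_norm_bound[OF assms(1) complex_normed_space_on_UNIV _ assms(3)]) (simp add: dual_def)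

lemma dual_norm_leI:
  assumes "complex_normed_space_on V N" and "0 \<le> c" and "\<And>x. x \<in> V \<Longrightarrow> cmod (f x) \<le> c * N x"
  shows "dual_norm V N f \<le> c"
  unfolding dual_norm_def by (rule op_norm_leI[OF assms(1,2)]) (rule assms(3))

lemma dual_norm_nonneg:
  assumes "complex_normed_space_on V N" and "f \<in> dual V N"
  shows "0 \<le> dual_norm V N f"
  unfolding dual_norm_def using assms(2)
  by (intro op_norm_nonneg[OF assms(1) complex_normed_space_on_UNIV]) (simp add: dual_def)

text \<open>Stated for an arbitrary normed subspace, so that applying it to its own conclusion
  equips the bidual with its norm.\<close>

lemma complex_normed_space_on_dual:
  assumes "complex_normed_space_on V N"
  shows "complex_normed_space_on (dual V N) (dual_norm V N)"
proof -
  interpret complex_normed_space_on V N by fact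
  note bound = dual_bound[OF assms] and ge0 = dual_norm_nonneg[OF assms]
  have 0: "0 \<in> dual V N"
    by (rule dualI[where c = 0]) (auto simp: clinear_on_def scaleC_complex_def)
  have add_bound: "cmod ((f + g) x) \<le> (dual_norm V N f + dual_norm V N g) * N x"
    if "f \<in> dual V N" "g \<in> dual V N" "x \<in> V" for f g x
  proof -
    have "cmod ((f + g) x) \<le> cmod (f x) + cmod (g x)" by (simp add: norm_triangle_ineq)
    then show ?thesis using bound[OF that(1,3)] bound[OF that(2,3)] by (simp add: distrib_right)
  qed
  have add: "f + g \<in> dual V N" if fg: "f \<in> dual V N" "g \<in> dual V N" for f g
  proof (rule dualI[OF _ add_bound[OF fg]])
    show "clinear_on V (f + g)"
      using fg[THEN dual_clinear] by (auto simp: clinear_on_def scaleC_complex_def algebra_simps)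
    show "(f + g) x = 0" if "x \<notin> V" for x using fg that by (auto simp: dual_def)
  qed
  have scale_bound: "cmod ((a *\<^sub>C f) x) \<le> (cmod a * dual_norm V N f) * N x"
    if "f \<in> dual V N" "x \<in> V" for a f x
    using mult_left_mono[OF bound[OF that], of "cmod a"]
    by (simp add: scaleC_fun_def scaleC_complex_def norm_mult mult.assoc)
  have scale: "a *\<^sub>C f \<in> dual V N" if f: "f \<in> dual V N" for a f
  proof (rule dualI[OF _ scale_bound[OF f]])
    show "clinear_on V (a *\<^sub>C f)"
      using dual_clinear[OF f] by (auto simp: clinear_on_def scaleC_fun_def scaleC_complex_def algebra_simps)
    show "(a *\<^sub>C f) x = 0" if "x \<notin> V" for x
      using f that by (auto simp: dual_def scaleC_fun_def scaleC_complex_def)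
  qed
  have scale_le: "dual_norm V N (a *\<^sub>C f) \<le> cmod a * dual_norm V N f" if f: "f \<in> dual V N" for a f
    by (rule dual_norm_leI[OF assms _ scale_bound[OF f]]) (simp add: ge0 f)
  show ?thesis
  proof
    show "csubspace (dual V N)"
      unfolding complex_vector.subspace_def using 0 add scale by blast
    show "0 \<le> dual_norm V N f" if "f \<in> dual V N" for f by (rule ge0[OF that])
    show "dual_norm V N f = 0 \<longleftrightarrow> f = 0" if f: "f \<in> dual V N" for f
    proof
      assume *: "dual_norm V N f = 0"
      show "f = 0"
      proof
        fix x show "f x = 0 x"
          using bound[OF f, of x] f * by (cases "x \<in> V") (auto simp: dual_def)
      qed
    next
      assume "f = 0"
      then have "dual_norm V N f \<le> 0" by (intro dual_norm_leI[OF assms]) auto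
      then show "dual_norm V N f = 0" using ge0[OF f] by simp
    qed
    show "dual_norm V N (f + g) \<le> dual_norm V N f + dual_norm V N g"
      if "f \<in> dual V N" "g \<in> dual V N" for f g
      by (rule dual_norm_leI[OF assms _ add_bound[OF that]]) (simp add: ge0 that)
    show "dual_norm V N (a *\<^sub>C f) = cmod a * dual_norm V N f" if f: "f \<in> dual V N" for a f
    proof (cases "a = 0")
      case True
      then have "dual_norm V N (a *\<^sub>C f) \<le> 0" using scale_le[OF f, of a] by simp
      then show ?thesis using ge0[OF scale[OF f], of a] True by simp
    next
      case False
      \<comment> \<open>The inequality \<open>scale_le\<close> for the inverse scalar supplies the
        reverse estimate.\<close>
      have "dual_norm V N f = dual_norm V N (inverse a *\<^sub>C a *\<^sub>C f)" using False by (simp add: scaleC_one)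
      also have "\<dots> \<le> cmod (inverse a) * dual_norm V N (a *\<^sub>C f)" by (rule scale_le[OF scale[OF f]])
      finally have "cmod a * dual_norm V N f \<le> dual_norm V N (a *\<^sub>C f)"
        using False by (simp add: norm_divide field_simps)
      then show ?thesis using scale_le[OF f, of a] by simp
    qed
  qed
qed

section \<open>Norm preserving extension and separation of points\<close>

lemma dual_extend:
  fixes X :: "'z::complex_normed_vector set"
  assumes X: "csubspace X" and f: "f \<in> dual X norm"
  shows "\<exists>g. clinear_on UNIV g \<and> (\<forall>z. cmod (g z) \<le> dual_norm X norm f * norm z) \<and> (\<forall>x\<in>X. g x = f x)"
proof -
  have XN: "complex_normed_space_on X norm"
    by (rule complex_normed_space_on_subset[OF complex_normed_space_on_UNIV X]) simp
  have c: "0 \<le> dual_norm X norm f" by (rule dual_norm_nonneg[OF XN f])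
  have "clinear_on X (\<lambda>x. x)" by (simp add: clinear_on_def)
  from hahn_banach[OF _ X this _ dual_clinear[OF f], of UNIV "\<lambda>z. dual_norm X norm f * norm z"]
  show ?thesis
    using dual_bound[OF XN f] mult_left_mono[OF norm_triangle_ineq c]
    by (auto simp: norm_scaleC distrib_left)
qed

lemma dual_ball_bound:
  assumes "g \<in> dual_ball"
  shows "g \<in> dual UNIV norm" and "cmod (g y) \<le> norm y"
proof -
  show g: "g \<in> dual UNIV norm" using assms by (simp add: dual_ball_def)
  have "dual_norm UNIV norm g * norm y \<le> 1 * norm y"
    using assms by (intro mult_right_mono) (auto simp: dual_ball_def)
  then show "cmod (g y) \<le> norm y"
    using dual_bound[OF complex_normed_space_on_UNIV g, of y] by simp
qed

text \<open>Hahn-Banach along the map \<open>a *\<^sub>C y\<close> from the scalars, where the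
  functional \<open>a * norm y\<close> is prescribed; this covers \<open>y = 0\<close> as
  well.\<close>

lemma exists_norming_functional:
  fixes y :: "'y::complex_normed_vector"
  shows "\<exists>g\<in>dual_ball. g y = complex_of_real (norm y)"
proof -
  have "clinear_on UNIV (\<lambda>a::complex. a *\<^sub>C y)" "clinear_on UNIV (\<lambda>a::complex. a * complex_of_real (norm y))"
    by (simp_all add: clinear_on_def scaleC_add_left scaleC_complex_def distrib_right)
  from hahn_banach[OF _ _ this(1) _ this(2), of UNIV norm]
  obtain g where g: "clinear_on UNIV g" "\<And>x. cmod (g x) \<le> norm x"
    "\<And>a. g (a *\<^sub>C y) = a * complex_of_real (norm y)"
    by (auto simp: norm_triangle_ineq norm_scaleC norm_mult)
  have "g \<in> dual UNIV norm" by (rule dualI[where c = 1]) (auto simp: g)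
  moreover have "dual_norm UNIV norm g \<le> 1"
    by (rule dual_norm_leI[OF complex_normed_space_on_UNIV]) (auto simp: g)
  ultimately show ?thesis using g(3)[of 1] by (auto simp: dual_ball_def scaleC_one)
qed

text \<open>Serves to identify points that are known only through their pairings: linearity of the
  extension, its agreement with \<open>T\<close> on \<open>X\<close>, and its representation by an
  arbitrary dominating sequence all reduce to scalar identities.\<close>

lemma dual_separates:
  fixes y z :: "'y::complex_normed_vector"
  assumes "\<And>g. g \<in> dual UNIV norm \<Longrightarrow> g y = g z"
  shows "y = z"
proof -
  obtain g where g: "g \<in> dual_ball" "g (y - z) = complex_of_real (norm (y - z))"
    using exists_norming_functional by blast
  have "g (y - z) = g y - g z"
    using clinear_on_diff[OF dual_clinear[OF dual_ball_bound(1)[OF g(1)]]] by simp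
  then show ?thesis using g(2) assms[OF dual_ball_bound(1)[OF g(1)]] by simp
qed

lemma bounded_linear_dual:
  fixes g :: "'y::complex_normed_vector \<Rightarrow> complex"
  assumes g: "g \<in> dual UNIV norm"
  shows "bounded_linear g"
proof (rule bounded_linear_intro)
  note lin = clinear_on_simps[OF dual_clinear[OF g]]
  show "g (x + y) = g x + g y" for x y using lin by simp
  show "g (r *\<^sub>R x) = r *\<^sub>R g x" for r x using lin by (simp add: scaleR_scaleC)
  show "norm (g x) \<le> norm x * dual_norm UNIV norm g" for x
    using dual_bound[OF complex_normed_space_on_UNIV g, of x] by (simp add: mult.commute)
qed

section \<open>Weakly p-summable sequences and the operator \<open>E_op\<close>\<close>

lemma norm_w_eq: "norm_w p y = (SUP f\<in>dual_ball. norm_s p (\<lambda>n. f (y n)))"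
  by (simp add: norm_w_def norm_s_def)

lemma ell_w_eq:
  "ell_w p = {y. (\<forall>f\<in>dual_ball. (\<lambda>n. f (y n)) \<in> ell_s p) \<and> bdd_above ((\<lambda>f. norm_s p (\<lambda>n. f (y n))) ` dual_ball)}"
  by (simp add: ell_w_def norm_s_def ell_s_def)

lemma norm_s_le_norm_w:
  assumes "y \<in> ell_w p" and "g \<in> dual_ball"
  shows "norm_s p (\<lambda>n. g (y n)) \<le> norm_w p y"
  unfolding norm_w_eq using assms by (intro cSUP_upper) (auto simp: ell_w_eq)

lemma dual_ball_nonempty: "dual_ball \<noteq> {}"
  using exists_norming_functional by blast

lemma norm_w_nonneg:
  assumes "y \<in> ell_w p"
  shows "0 \<le> norm_w p y"
  using dual_ball_nonempty norm_s_le_norm_w[OF assms] norm_s_nonneg order_trans by blast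

lemma ell_w_dual:
  assumes y: "y \<in> ell_w p" and p: "1 < p" and g: "g \<in> dual UNIV norm"
  shows "(\<lambda>n. g (y n)) \<in> ell_s p"
proof -
  interpret D: complex_normed_space_on "dual UNIV norm :: ('a \<Rightarrow> complex) set" "dual_norm UNIV norm"
    by (rule complex_normed_space_on_dual[OF complex_normed_space_on_UNIV])
  \<comment> \<open>The added 1 keeps the divisor positive when \<open>g = 0\<close>.\<close>
  define c where "c = dual_norm UNIV norm g + 1"
  have c: "c > 0" "dual_norm UNIV norm g \<le> c" using D.nonneg[OF g] by (auto simp: c_def)
  let ?a = "complex_of_real (inverse c)"
  have a: "cmod ?a = inverse c" unfolding norm_of_real using c by simp
  have "dual_norm UNIV norm (?a *\<^sub>C g) \<le> 1"
    unfolding D.homogeneous[OF g] a using c by (simp add: field_simps)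
  then have "?a *\<^sub>C g \<in> dual_ball"
    using csubspace_memI(3)[OF D.csubspace g] by (simp add: dual_ball_def)
  then have "(\<lambda>n. (?a *\<^sub>C g) (y n)) \<in> ell_s p" using y by (simp add: ell_w_eq)
  then have "(\<lambda>n. complex_of_real c *\<^sub>C (?a *\<^sub>C g) (y n)) \<in> ell_s p" by (rule ell_s_scale(1)[OF _ p])
  moreover have "complex_of_real c *\<^sub>C (?a *\<^sub>C g) (y n) = g (y n)" for n
    using c by (simp add: scaleC_fun_def scaleC_complex_def)
  ultimately show ?thesis by simp
qed

text \<open>Functionals in the dual ball do not increase norms. Through this inclusion the p-compact
  case inherits the extension built for weakly p-compact operators.\<close>

lemma ell_s_subset_ell_w:
  assumes p: "1 < p"
  shows "ell_s p \<subseteq> ell_w p"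
proof
  fix y :: "nat \<Rightarrow> 'a" assume y: "y \<in> ell_s p"
  have le: "(\<Sum>n<m. norm (f (y n)) powr p) \<le> norm_s p y powr p" if "f \<in> dual_ball" for f m
  proof -
    have "(\<Sum>n<m. norm (f (y n)) powr p) \<le> (\<Sum>n<m. norm (y n) powr p)"
      using p dual_ball_bound(2)[OF that] by (intro sum_mono powr_mono2) auto
    also have "\<dots> \<le> norm_s p y powr p" by (rule sum_le_norm_s_powr[OF y p]) simp
    finally show ?thesis .
  qed
  note b = ell_s_boundI[OF p norm_s_nonneg le]
  show "y \<in> ell_w p"
    unfolding ell_w_eq using b by (auto intro!: bdd_aboveI2)
qed

text \<open>The partial sums are Cauchy by Hoelder's inequality, applied to a norming functional
  of each block of the series.\<close>

lemma summable_E_op: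
  fixes y :: "nat \<Rightarrow> 'y::cbanach"
  assumes y: "y \<in> ell_w p" and p: "1 < p" and \<alpha>: "\<alpha> \<in> ell_s (conj_exp p)"
  shows "summable (\<lambda>n. \<alpha> n *\<^sub>C y n)"
proof -
  let ?q = "conj_exp p" and ?w = "norm_w p y"
  have q: "1 < ?q" using conj_exp_gt_1[OF p] .
  have block: "norm (\<Sum>n\<in>K. \<alpha> n *\<^sub>C y n) \<le> ?w * (\<Sum>n\<in>K. cmod (\<alpha> n) powr ?q) powr (1 / ?q)"
    if K: "finite K" for K
  proof -
    obtain g where g: "g \<in> dual_ball"
      "g (\<Sum>n\<in>K. \<alpha> n *\<^sub>C y n) = complex_of_real (norm (\<Sum>n\<in>K. \<alpha> n *\<^sub>C y n))"
      using exists_norming_functional by blast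
    note gd = dual_ball_bound(1)[OF g(1)]
    interpret g: bounded_linear g by (rule bounded_linear_dual[OF gd])
    have "norm (\<Sum>n\<in>K. \<alpha> n *\<^sub>C y n) = cmod (g (\<Sum>n\<in>K. \<alpha> n *\<^sub>C y n))"
      using g(2) by simp
    also have "g (\<Sum>n\<in>K. \<alpha> n *\<^sub>C y n) = (\<Sum>n\<in>K. \<alpha> n * g (y n))"
      using clinear_on_simps(2)[OF dual_clinear[OF gd]] by (simp add: g.sum scaleC_complex_def)
    also have "cmod \<dots> \<le> (\<Sum>n\<in>K. cmod (g (y n)) * cmod (\<alpha> n))"
      by (rule order_trans[OF norm_sum]) (simp add: norm_mult mult.commute)
    also have "\<dots> \<le> norm_s p (\<lambda>n. g (y n)) * (\<Sum>n\<in>K. cmod (\<alpha> n) powr ?q) powr (1 / ?q)"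
      using sum_le_norm_s_powr[OF ell_w_dual[OF y p gd] p K] q
      by (intro holder_sum[OF p K]) (auto simp: norm_s_nonneg powr_powr sum_nonneg)
    also have "\<dots> \<le> ?w * (\<Sum>n\<in>K. cmod (\<alpha> n) powr ?q) powr (1 / ?q)"
      by (intro mult_right_mono norm_s_le_norm_w[OF y g(1)]) simp
    finally show ?thesis .
  qed
  show ?thesis
    unfolding summable_Cauchy
  proof (intro allI impI)
    fix e :: real assume e: "0 < e"
    have w: "0 \<le> ?w" by (rule norm_w_nonneg[OF y])
    \<comment> \<open>Chosen so that a block of coefficients with sum below \<open>d\<close> makes
      the bound in \<open>block\<close> smaller than \<open>e\<close>; \<open>?w + 1\<close>
      replaces \<open>?w\<close> to avoid a zero denominator.\<close>
    define d where "d = (e / (?w + 1)) powr ?q"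
    have "d > 0" using e w by (simp add: d_def)
    moreover have "summable (\<lambda>n. cmod (\<alpha> n) powr ?q)" using \<alpha> by (simp add: ell_s_def)
    ultimately obtain M where M: "\<And>m n. M \<le> m \<Longrightarrow> norm (\<Sum>k = m..<n. cmod (\<alpha> k) powr ?q) < d"
      unfolding summable_Cauchy by blast
    have "norm (\<Sum>k = m..<n. \<alpha> k *\<^sub>C y k) < e" if "M \<le> m" for m n
    proof -
      let ?S = "\<Sum>k = m..<n. cmod (\<alpha> k) powr ?q"
      have S: "0 \<le> ?S" by (simp add: sum_nonneg)
      have "?S powr (1 / ?q) < d powr (1 / ?q)"
        using M[OF that, of n] S q by (intro powr_less_mono2) auto
      also have "\<dots> = e / (?w + 1)" using e w q by (simp add: d_def powr_powr)
      finally have "(?w + 1) * ?S powr (1 / ?q) < e" using w by (simp add: field_simps)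
      moreover have "?w * ?S powr (1 / ?q) \<le> (?w + 1) * ?S powr (1 / ?q)" by (intro mult_right_mono) auto
      ultimately show ?thesis using block[of "{m..<n}"] by simp
    qed
    then show "\<exists>M. \<forall>m\<ge>M. \<forall>n. norm (\<Sum>k = m..<n. \<alpha> k *\<^sub>C y k) < e" by blast
  qed
qed

lemma dual_E_op:
  fixes y :: "nat \<Rightarrow> 'y::cbanach"
  assumes y: "y \<in> ell_w p" and p: "1 < p" and \<alpha>: "\<alpha> \<in> ell_s (conj_exp p)" and g: "g \<in> dual UNIV norm"
  shows "g (E_op y \<alpha>) = (\<Sum>n. \<alpha> n * g (y n))"
  using bounded_linear.suminf[OF bounded_linear_dual[OF g] summable_E_op[OF y p \<alpha>]]
    clinear_on_simps(2)[OF dual_clinear[OF g]]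
  by (simp add: E_op_def scaleC_complex_def)

definition adjoint_on :: "'x set \<Rightarrow> ('x \<Rightarrow> 'y) \<Rightarrow> ('y \<Rightarrow> complex) \<Rightarrow> 'x \<Rightarrow> complex" where
  "adjoint_on X T g = (\<lambda>x. if x \<in> X then g (T x) else 0)"

text \<open>The value 0 off \<open>X\<close> in \<open>adjoint_on\<close> matches the representation
  of functionals in \<open>dual\<close>, so elements of the bidual can be applied to the
  result.\<close>

lemma adjoint_on_dual:
  fixes T :: "'x::complex_vector \<Rightarrow> 'y::complex_normed_vector"
  assumes X: "complex_normed_space_on X N" and T: "T \<in> bounded_ops X N UNIV norm" and g: "g \<in> dual UNIV norm"
  shows "adjoint_on X T g \<in> dual X N"
proof (rule dualI)
  interpret complex_normed_space_on X N by fact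
  show "clinear_on X (adjoint_on X T g)"
    using T clinear_on_simps[OF dual_clinear[OF g]] csubspace_memI(2,3)[OF csubspace]
    by (auto simp: clinear_on_def adjoint_on_def bounded_ops_def)
  show "cmod (adjoint_on X T g x) \<le> (dual_norm UNIV norm g * op_norm X N norm T) * N x" if x: "x \<in> X" for x
  proof -
    have "cmod (g (T x)) \<le> dual_norm UNIV norm g * norm (T x)"
      by (rule dual_bound[OF complex_normed_space_on_UNIV g]) simp
    also have "\<dots> \<le> dual_norm UNIV norm g * (op_norm X N norm T * N x)"
      by (intro mult_left_mono op_norm_bound[OF X complex_normed_space_on_UNIV T x]
          dual_norm_nonneg[OF complex_normed_space_on_UNIV g])
    finally show ?thesis using x by (simp add: adjoint_on_def mult.assoc)
  qed
qed (simp add: adjoint_on_def)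

text \<open>On the unit ball \<open>T x\<close> is some \<open>E_op y \<alpha>\<close> with
  \<open>\<alpha>\<close> in the unit ball of ell_q, and Hoelder's inequality applies to the pairing
  with \<open>g\<close>. Bounding by the sequence \<open>g (y n)\<close> itself, not just by the
  norm of \<open>g\<close>, is what lets functionals on the bidual side factor through
  ell_p.\<close>

lemma adjoint_on_norm_le:
  fixes T :: "'x::complex_normed_vector \<Rightarrow> 'y::cbanach"
  assumes X: "csubspace X" and T: "clinear_on X T"
    and y: "y \<in> ell_w p" and p: "1 < p" and dom: "dominates p X T y" and g: "g \<in> dual UNIV norm"
  shows "dual_norm X norm (adjoint_on X T g) \<le> norm_s p (\<lambda>n. g (y n))"
proof -
  have XN: "complex_normed_space_on X norm"
    by (rule complex_normed_space_on_subset[OF complex_normed_space_on_UNIV X]) simp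
  show ?thesis
    unfolding dual_norm_def op_norm_def
  proof (rule cSUP_least)
    show "{x \<in> X. norm x \<le> 1} \<noteq> {}" using csubspace_memI(1)[OF X] by force
    fix x assume x: "x \<in> {x \<in> X. norm x \<le> 1}"
    then obtain \<alpha> where \<alpha>: "\<alpha> \<in> ell_s (conj_exp p)" "norm_s (conj_exp p) \<alpha> \<le> 1" "T x = E_op y \<alpha>"
      using dom by (force simp: dominates_def ell_ball_def)
    have "cmod (g (T x)) \<le> norm_s (conj_exp p) \<alpha> * norm_s p (\<lambda>n. g (y n))"
      unfolding \<alpha>(3) dual_E_op[OF y p \<alpha>(1) g] by (rule holder_ell_s(2)[OF p ell_w_dual[OF y p g] \<alpha>(1)])
    also have "\<dots> \<le> 1 * norm_s p (\<lambda>n. g (y n))" by (intro mult_right_mono \<alpha>(2) norm_s_nonneg)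
    finally show "cmod (adjoint_on X T g x) \<le> norm_s p (\<lambda>n. g (y n))" using x by (simp add: adjoint_on_def)
  qed
qed

text \<open>The second adjoint of \<open>T\<close> maps \<open>\<phi>\<close> to the \<open>E_op y \<alpha>\<close> found here; in particular it takes values in the
  codomain of \<open>T\<close>. The coefficients \<open>\<alpha>\<close> represent a norm preserving extension to \<open>ell_s p\<close>
  of the functional that sends the sequence \<open>g (y n)\<close> to \<open>\<phi>\<close> applied to \<open>g \<circ> T\<close>.\<close>

lemma second_adjoint_E_op:
  fixes T :: "'x::complex_normed_vector \<Rightarrow> 'y::cbanach"
  assumes X: "csubspace X" and T: "T \<in> bounded_ops X norm UNIV norm"
    and y: "y \<in> ell_w p" and p: "1 < p" and dom: "dominates p X T y" and \<phi>: "\<phi> \<in> bidual X norm"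
  shows "\<exists>\<alpha>\<in>ell_s (conj_exp p). norm_s (conj_exp p) \<alpha> \<le> bidual_norm X norm \<phi> \<and>
    (\<forall>g\<in>dual UNIV norm. g (E_op y \<alpha>) = \<phi> (adjoint_on X T g))"
proof -
  have XN: "complex_normed_space_on X norm"
    by (rule complex_normed_space_on_subset[OF complex_normed_space_on_UNIV X]) simp
  interpret DX: complex_normed_space_on "dual X norm" "dual_norm X norm"
    by (rule complex_normed_space_on_dual[OF XN])
  interpret DY: complex_normed_space_on "dual UNIV norm :: ('y \<Rightarrow> complex) set" "dual_norm UNIV norm"
    by (rule complex_normed_space_on_dual[OF complex_normed_space_on_UNIV])
  let ?c = "bidual_norm X norm \<phi>"
  have lin_T: "clinear_on X T" using T by (simp add: bounded_ops_def)
  note \<phi>' = \<phi>[unfolded bidual_def]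
  have c: "0 \<le> ?c" unfolding bidual_norm_def
    by (rule dual_norm_nonneg[OF DX.complex_normed_space_on_axioms \<phi>'])
  note adj = adjoint_on_dual[OF XN T]
  \<comment> \<open>This map is the adjoint of \<open>E_op y\<close>. It may have a kernel; the
    estimate \<open>h_le\<close> shows that the functional in \<open>h\<close> depends on
    \<open>g\<close> only through the sequence \<open>g (y n)\<close>.\<close>
  have S: "clinear_on (dual UNIV norm) (\<lambda>g n. g (y n))"
    by (auto simp: clinear_on_def plus_fun_def scaleC_fun_def)
  have S_in: "(\<lambda>g n. g (y n)) ` dual UNIV norm \<subseteq> ell_s p" using ell_w_dual[OF y p] by auto
  have h: "clinear_on (dual UNIV norm) (\<lambda>g. \<phi> (adjoint_on X T g))"
    unfolding clinear_on_def
  proof (intro conjI ballI allI)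
    fix f g :: "'y \<Rightarrow> complex" assume fg: "f \<in> dual UNIV norm" "g \<in> dual UNIV norm"
    have "adjoint_on X T (f + g) = adjoint_on X T f + adjoint_on X T g"
      by (auto simp: adjoint_on_def fun_eq_iff)
    then show "\<phi> (adjoint_on X T (f + g)) = \<phi> (adjoint_on X T f) + \<phi> (adjoint_on X T g)"
      using clinear_on_simps(1)[OF dual_clinear[OF \<phi>'] adj[OF fg(1)] adj[OF fg(2)]] by simp
  next
    fix a and f :: "'y \<Rightarrow> complex" assume f: "f \<in> dual UNIV norm"
    have "adjoint_on X T (a *\<^sub>C f) = a *\<^sub>C adjoint_on X T f"
      by (auto simp: adjoint_on_def fun_eq_iff scaleC_fun_def)
    then show "\<phi> (adjoint_on X T (a *\<^sub>C f)) = a *\<^sub>C \<phi> (adjoint_on X T f)"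
      using clinear_on_simps(2)[OF dual_clinear[OF \<phi>'] adj[OF f]] by simp
  qed
  have h_le: "cmod (\<phi> (adjoint_on X T g)) \<le> ?c * norm_s p (\<lambda>n. g (y n))" if g: "g \<in> dual UNIV norm" for g
  proof -
    have "cmod (\<phi> (adjoint_on X T g)) \<le> ?c * dual_norm X norm (adjoint_on X T g)"
      unfolding bidual_norm_def by (rule dual_bound[OF DX.complex_normed_space_on_axioms \<phi>' adj[OF g]])
    also have "\<dots> \<le> ?c * norm_s p (\<lambda>n. g (y n))"
      by (intro mult_left_mono c adjoint_on_norm_le[OF X lin_T y p dom g])
    finally show ?thesis .
  qed
  have "\<exists>F. clinear_on (ell_s p) F \<and> (\<forall>x\<in>ell_s p. cmod (F x) \<le> ?c * norm_s p x) \<and>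
      (\<forall>g\<in>dual UNIV norm. F (\<lambda>n. g (y n)) = \<phi> (adjoint_on X T g))"
  proof (rule hahn_banach[OF csubspace_ell_s[OF p] DY.csubspace S S_in h])
    show "cmod (\<phi> (adjoint_on X T g)) \<le> ?c * norm_s p (\<lambda>n. g (y n))" if "g \<in> dual UNIV norm" for g
      by (rule h_le[OF that])
  next
    fix u v :: "nat \<Rightarrow> complex" assume "u \<in> ell_s p" "v \<in> ell_s p"
    from mult_left_mono[OF ell_s_add(2)[OF this p] c]
    show "?c * norm_s p (u + v) \<le> ?c * norm_s p u + ?c * norm_s p v"
      by (simp add: plus_fun_def distrib_left)
  next
    fix a and u :: "nat \<Rightarrow> complex" assume "u \<in> ell_s p"
    from ell_s_scale(2)[OF this p, of a]
    show "?c * norm_s p (a *\<^sub>C u) = cmod a * (?c * norm_s p u)" by (simp add: scaleC_fun_def)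
  qed
  then obtain F where F: "clinear_on (ell_s p) F" "\<And>x. x \<in> ell_s p \<Longrightarrow> cmod (F x) \<le> ?c * norm_s p x"
    "\<And>g. g \<in> dual UNIV norm \<Longrightarrow> F (\<lambda>n. g (y n)) = \<phi> (adjoint_on X T g)" by blast
  from ell_s_dual_representation[OF p F(1) c F(2)]
  obtain \<alpha> where \<alpha>: "\<alpha> \<in> ell_s (conj_exp p)" "norm_s (conj_exp p) \<alpha> \<le> ?c"
    "\<And>x. x \<in> ell_s p \<Longrightarrow> (\<lambda>n. \<alpha> n * x n) sums F x" by blast
  have "g (E_op y \<alpha>) = \<phi> (adjoint_on X T g)" if g: "g \<in> dual UNIV norm" for g
    using \<alpha>(3)[OF ell_w_dual[OF y p g]] dual_E_op[OF y p \<alpha>(1) g] F(3)[OF g] by (simp add: sums_iff)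
  with \<alpha>(1,2) show ?thesis by blast
qed

section \<open>Extension through the bidual\<close>

definition bounded_functions :: "('i \<Rightarrow> complex) set" where
  "bounded_functions = {f. bdd_above (range (\<lambda>s. cmod (f s)))}"

definition sup_norm :: "('i \<Rightarrow> complex) \<Rightarrow> real" where
  "sup_norm f = (SUP s. cmod (f s))"

lemma bounded_functionsI: "(\<And>s. cmod (f s) \<le> C) \<Longrightarrow> f \<in> bounded_functions"
  unfolding bounded_functions_def by (intro CollectI bdd_aboveI2)

lemma norm_le_sup_norm: "f \<in> bounded_functions \<Longrightarrow> cmod (f s) \<le> sup_norm f"
  by (auto simp: bounded_functions_def sup_norm_def intro: cSUP_upper)

lemma sup_norm_leI: "(\<And>s. cmod (f s) \<le> C) \<Longrightarrow> sup_norm f \<le> C"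
  by (auto simp: sup_norm_def intro: cSUP_least)

lemma sup_norm_nonneg: "f \<in> bounded_functions \<Longrightarrow> 0 \<le> sup_norm f"
  by (rule order_trans[OF norm_ge_zero norm_le_sup_norm])

lemma complex_normed_space_on_bounded_functions:
  "complex_normed_space_on (bounded_functions :: ('i \<Rightarrow> complex) set) sup_norm"
proof
  have add_le: "cmod ((f + g) s) \<le> sup_norm f + sup_norm g"
    if "f \<in> bounded_functions" "g \<in> bounded_functions" for f g :: "'i \<Rightarrow> complex" and s
    using norm_triangle_ineq[of "f s" "g s"] norm_le_sup_norm[OF that(1), of s] norm_le_sup_norm[OF that(2), of s]
    by simp
  have add: "f + g \<in> bounded_functions" if "f \<in> bounded_functions" "g \<in> bounded_functions" for f g :: "'i \<Rightarrow> complex"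
    using add_le[OF that] by (rule bounded_functionsI)
  have scale_le: "cmod ((a *\<^sub>C f) s) \<le> cmod a * sup_norm f"
    if "f \<in> bounded_functions" for f :: "'i \<Rightarrow> complex" and a s
    using mult_left_mono[OF norm_le_sup_norm[OF that, of s], of "cmod a"]
    by (simp add: scaleC_fun_def scaleC_complex_def norm_mult)
  have scale: "a *\<^sub>C f \<in> bounded_functions" if "f \<in> bounded_functions" for f :: "'i \<Rightarrow> complex" and a
    using scale_le[OF that] by (rule bounded_functionsI)
  show "csubspace (bounded_functions :: ('i \<Rightarrow> complex) set)"
    unfolding complex_vector.subspace_def
    using add scale by (auto intro: bounded_functionsI[of 0 0])
  fix f g :: "'i \<Rightarrow> complex" and a :: complex
  assume f: "f \<in> bounded_functions"
  show "0 \<le> sup_norm f" using f by (rule sup_norm_nonneg)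
  show "sup_norm f = 0 \<longleftrightarrow> f = 0"
  proof
    assume "sup_norm f = 0"
    then have "cmod (f s) \<le> 0" for s using norm_le_sup_norm[OF f, of s] by simp
    then show "f = 0" by (auto simp: fun_eq_iff)
  next
    assume "f = 0"
    then show "sup_norm f = 0" by (simp add: sup_norm_def)
  qed
  show "sup_norm (f + g) \<le> sup_norm f + sup_norm g" if "g \<in> bounded_functions"
    using add_le[OF f that] by (rule sup_norm_leI)
  show "sup_norm (a *\<^sub>C f) = cmod a * sup_norm f"
  proof (cases "a = 0")
    case True
    then show ?thesis by (simp add: sup_norm_def)
  next
    case False
    have "sup_norm (inverse a *\<^sub>C a *\<^sub>C f) \<le> cmod (inverse a) * sup_norm (a *\<^sub>C f)"
      using scale_le[OF scale[OF f]] by (rule sup_norm_leI)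
    then have "cmod a * sup_norm f \<le> sup_norm (a *\<^sub>C f)"
      using False by (simp add: scaleC_one norm_divide field_simps)
    moreover have "sup_norm (a *\<^sub>C f) \<le> cmod a * sup_norm f"
      using scale_le[OF f] by (rule sup_norm_leI)
    ultimately show ?thesis by simp
  qed
qed

lemma complex_banach_space_on_bounded_functions:
  "complex_banach_space_on (bounded_functions :: ('i \<Rightarrow> complex) set) sup_norm"
proof -
  interpret complex_normed_space_on "bounded_functions :: ('i \<Rightarrow> complex) set" sup_norm
    by (rule complex_normed_space_on_bounded_functions)
  show ?thesis
  proof
    fix s :: "nat \<Rightarrow> 'i \<Rightarrow> complex"
    assume s: "\<And>n. s n \<in> bounded_functions"
      and cauchy: "\<And>e. e > 0 \<Longrightarrow> \<exists>k. \<forall>m\<ge>k. \<forall>n\<ge>k. sup_norm (s m - s n) < e"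
    have le: "cmod (s m i - s n i) \<le> sup_norm (s m - s n)" for m n i
      using norm_le_sup_norm[OF csubspace_memI(4)[OF csubspace s s], of m n i] by simp
    have "Cauchy (\<lambda>n. s n i)" for i
    proof (rule metric_CauchyI)
      fix e :: real assume "e > 0"
      then obtain k where "\<forall>m\<ge>k. \<forall>n\<ge>k. sup_norm (s m - s n) < e" using cauchy by blast
      then have "\<forall>m\<ge>k. \<forall>n\<ge>k. dist (s m i) (s n i) < e"
        unfolding dist_norm using le_less_trans[OF le] by blast
      then show "\<exists>M. \<forall>m\<ge>M. \<forall>n\<ge>M. dist (s m i) (s n i) < e" ..
    qed
    then have "\<exists>l. (\<lambda>n. s n i) \<longlonglongrightarrow> l" for i
      using Cauchy_convergent convergent_def by blast
    then obtain x where x: "\<And>i. (\<lambda>n. s n i) \<longlonglongrightarrow> x i" by metis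
    \<comment> \<open>The Cauchy index \<open>k\<close> works for all coordinates \<open>i\<close>
      at once, so letting \<open>m\<close> tend to infinity in each coordinate gives uniform
      convergence.\<close>
    have tail: "\<exists>k. \<forall>n\<ge>k. \<forall>i. cmod ((s n - x) i) \<le> e" if e: "e > 0" for e
    proof -
      obtain k where k: "\<forall>m\<ge>k. \<forall>n\<ge>k. sup_norm (s m - s n) < e" using cauchy[OF e] by blast
      have "cmod (s n i - x i) \<le> e" if n: "n \<ge> k" for n i
      proof (rule tendsto_upperbound)
        show "(\<lambda>m. cmod (s n i - s m i)) \<longlonglongrightarrow> cmod (s n i - x i)"
          by (intro tendsto_intros x)
        show "\<forall>\<^sub>F m in sequentially. cmod (s n i - s m i) \<le> e"
          using eventually_ge_at_top[of k]
        proof eventually_elim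
          case (elim m)
          then show ?case using k n le[of n i m] by fastforce
        qed
      qed simp
      then show ?thesis by auto
    qed
    obtain k where k: "\<And>i. cmod ((s k - x) i) \<le> 1" using tail[of 1] by auto
    have "s k - (s k - x) \<in> bounded_functions"
      by (rule csubspace_memI(4)[OF csubspace s bounded_functionsI[OF k]])
    then have xb: "x \<in> bounded_functions" by simp
    have "(\<lambda>n. sup_norm (s n - x)) \<longlonglongrightarrow> 0"
    proof (rule LIMSEQ_I)
      fix e :: real assume "e > 0"
      \<comment> \<open>Half of \<open>e\<close>, because the passage to the limit turned the strict
        bound into a weak one.\<close>
      then obtain k where k: "\<forall>n\<ge>k. \<forall>i. cmod ((s n - x) i) \<le> e / 2" using tail[of "e / 2"] by auto
      have "norm (sup_norm (s n - x) - 0) < e" if n: "n \<ge> k" for n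
      proof -
        have "sup_norm (s n - x) \<le> e / 2" using k n by (intro sup_norm_leI) auto
        then show ?thesis
          using sup_norm_nonneg[OF csubspace_memI(4)[OF csubspace s xb], of n] \<open>e > 0\<close> by simp
      qed
      then show "\<exists>no. \<forall>n\<ge>no. norm (sup_norm (s n - x) - 0) < e" by blast
    qed
    with xb show "\<exists>x\<in>bounded_functions. (\<lambda>n. sup_norm (s n - x)) \<longlonglongrightarrow> 0" by blast
  qed
qed

section \<open>The canonical embedding and its extension with values in the bidual\<close>

lemma evaluation_bidual:
  assumes "complex_normed_space_on X N" and "x \<in> X"
  shows "(\<lambda>f. if f \<in> dual X N then f x else 0) \<in> bidual X N"
  unfolding bidual_def
proof (rule dualI)
  interpret D: complex_normed_space_on "dual X N" "dual_norm X N"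
    by (rule complex_normed_space_on_dual[OF assms(1)])
  show "clinear_on (dual X N) (\<lambda>f. if f \<in> dual X N then f x else 0)"
    using csubspace_memI(2,3)[OF D.csubspace] by (auto simp: clinear_on_def scaleC_fun_def)
  show "cmod (if f \<in> dual X N then f x else 0) \<le> N x * dual_norm X N f" if "f \<in> dual X N" for f
    using dual_bound[OF assms(1) that assms(2)] that by (simp add: mult.commute)
qed simp

text \<open>The bidual is embedded in the space of bounded functions on a set of functionals by evaluation at
  the unit ball of the dual; no Hahn-Banach argument is needed for this embedding to be isometric.\<close>

lemma P_space_bidual_extension:
  fixes X :: "'z::complex_normed_vector set"
  assumes X: "csubspace X" and P: "P_space lam (bidual X norm) (bidual_norm X norm)"
  shows "\<exists>L. clinear_on UNIV L \<and> (\<forall>z. L z \<in> bidual X norm \<and> bidual_norm X norm (L z) \<le> lam * norm z) \<and>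
    (\<forall>x\<in>X. \<forall>f\<in>dual X norm. L x f = f x)"
proof -
  let ?E = "bidual X norm" and ?N = "bidual_norm X norm"
  \<comment> \<open>The type is dictated by \<open>P_space\<close> for the bidual: the ambient space
    must consist of scalar functions on the type of all scalar functions on bidual elements.\<close>
  let ?F = "bounded_functions :: (((('z \<Rightarrow> complex) \<Rightarrow> complex) \<Rightarrow> complex) \<Rightarrow> complex) set"
  have XN: "complex_normed_space_on X norm"
    by (rule complex_normed_space_on_subset[OF complex_normed_space_on_UNIV X]) simp
  interpret D: complex_normed_space_on "dual X norm" "dual_norm X norm"
    by (rule complex_normed_space_on_dual[OF XN])
  interpret E: complex_normed_space_on ?E ?N
    unfolding bidual_def bidual_norm_def by (rule complex_normed_space_on_dual[OF D.complex_normed_space_on_axioms])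
  interpret F: complex_banach_space_on ?F sup_norm by (rule complex_banach_space_on_bounded_functions)
  define B where "B = {f \<in> dual X norm. dual_norm X norm f \<le> 1}"
  \<comment> \<open>A copy of the unit ball of the dual: each \<open>f\<close> is replaced by
    evaluation at \<open>f\<close>, which has the type of an index of \<open>?F\<close>. Coordinates
    outside \<open>D\<close> are filled with 0.\<close>
  define D where "D = (\<lambda>f \<phi>. \<phi> f :: complex) ` B"
  define j where "j \<phi> = (\<lambda>s. if s \<in> D then s \<phi> else 0 :: complex)" for \<phi> :: "('z \<Rightarrow> complex) \<Rightarrow> complex"
  let ?J = "\<lambda>x f. if f \<in> dual X norm then f x else 0 :: complex"
  have j_le: "cmod (j \<phi> s) \<le> ?N \<phi>" if \<phi>: "\<phi> \<in> ?E" for \<phi> s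
  proof (cases "s \<in> D")
    case True
    then obtain f where f: "f \<in> dual X norm" "dual_norm X norm f \<le> 1" "s = (\<lambda>\<phi>. \<phi> f)"
      by (auto simp: D_def B_def)
    have "cmod (\<phi> f) \<le> ?N \<phi> * dual_norm X norm f"
      using \<phi> unfolding bidual_def bidual_norm_def
      by (rule dual_bound[OF D.complex_normed_space_on_axioms _ f(1)])
    also have "\<dots> \<le> ?N \<phi> * 1" by (intro mult_left_mono f(2) E.nonneg[OF \<phi>])
    finally show ?thesis using True f(3) by (simp add: j_def)
  next
    case False
    then show ?thesis using E.nonneg[OF \<phi>] by (simp add: j_def)
  qed
  have jF: "j ` ?E \<subseteq> ?F" by (auto intro: bounded_functionsI j_le)
  have j_norm: "sup_norm (j \<phi>) = ?N \<phi>" if \<phi>: "\<phi> \<in> ?E" for \<phi>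
  proof (rule antisym)
    show "sup_norm (j \<phi>) \<le> ?N \<phi>" using j_le[OF \<phi>] by (rule sup_norm_leI)
    show "?N \<phi> \<le> sup_norm (j \<phi>)"
      unfolding bidual_norm_def dual_norm_def[of "dual X norm"] op_norm_def B_def[symmetric]
    proof (rule cSUP_least)
      have "dual_norm X norm 0 = 0" using D.eq_zero_iff[OF csubspace_memI(1)[OF D.csubspace]] by simp
      then have "0 \<in> B" using csubspace_memI(1)[OF D.csubspace] by (simp add: B_def)
      then show "B \<noteq> {}" by blast
      fix f assume f: "f \<in> B"
      have "cmod (j \<phi> (\<lambda>\<phi>. \<phi> f)) \<le> sup_norm (j \<phi>)"
        using jF \<phi> by (intro norm_le_sup_norm) auto
      then show "cmod (\<phi> f) \<le> sup_norm (j \<phi>)" using f by (simp add: j_def D_def)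
    qed
  qed
  have j_lin: "clinear_on ?E j"
    by (auto simp: clinear_on_def j_def D_def fun_eq_iff scaleC_fun_def)
  have j_inj: "\<phi> = \<psi>" if "\<phi> \<in> ?E" "\<psi> \<in> ?E" "j \<phi> = j \<psi>" for \<phi> \<psi>
  proof -
    have d: "\<phi> - \<psi> \<in> ?E" by (rule csubspace_memI(4)[OF E.csubspace that(1,2)])
    have "sup_norm (j (\<phi> - \<psi>)) = 0"
      using clinear_on_diff[OF j_lin E.csubspace that(1,2)] that(3) by (simp add: sup_norm_def)
    then show ?thesis using j_norm[OF d] E.eq_zero_iff[OF d] by simp
  qed
  have "\<forall>s\<in>D. \<exists>g. clinear_on UNIV g \<and> (\<forall>z. cmod (g z) \<le> norm z) \<and> (\<forall>x\<in>X. g x = s (?J x))"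
  proof
    fix s assume s: "s \<in> D"
    obtain f where f: "f \<in> dual X norm" "dual_norm X norm f \<le> 1" "s = (\<lambda>\<phi>. \<phi> f)"
      using s by (auto simp: D_def B_def)
    obtain g where g: "clinear_on UNIV g" "\<And>z. cmod (g z) \<le> dual_norm X norm f * norm z" "\<And>x. x \<in> X \<Longrightarrow> g x = f x"
      using dual_extend[OF X f(1)] by blast
    have "cmod (g z) \<le> norm z" for z
      using g(2)[of z] mult_right_mono[OF f(2) norm_ge_zero[of z]] by simp
    with g f show "\<exists>g. clinear_on UNIV g \<and> (\<forall>z. cmod (g z) \<le> norm z) \<and> (\<forall>x\<in>X. g x = s (?J x))"
      by (intro exI[of _ g]) simp
  qed
  from bchoice[OF this]
  obtain ext where ext: "\<And>s. s \<in> D \<Longrightarrow> clinear_on UNIV (ext s)"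
    "\<And>s z. s \<in> D \<Longrightarrow> cmod (ext s z) \<le> norm z" "\<And>s x. s \<in> D \<Longrightarrow> x \<in> X \<Longrightarrow> ext s x = s (?J x)"
    by blast
  \<comment> \<open>Coordinatewise extension of \<open>j\<close> composed with the canonical
    embedding of \<open>X\<close>. Every coordinate on \<open>D\<close> is bounded by
    \<open>norm z\<close>, so the sup norm of \<open>G z\<close> is too.\<close>
  define G where "G z = (\<lambda>s. if s \<in> D then ext s z else 0)" for z
  have G_le: "cmod (G z s) \<le> norm z" for z s using ext(2) by (simp add: G_def)
  have GF: "G z \<in> ?F" for z using G_le by (rule bounded_functionsI)
  have G_lin: "G (z + w) = G z + G w" "G (a *\<^sub>C z) = a *\<^sub>C G z" for z w a
    using clinear_on_simps[OF ext(1)] by (auto simp: G_def fun_eq_iff scaleC_fun_def)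
  have G_X: "G x = j (?J x)" if "x \<in> X" for x
    using ext(3)[OF _ that] by (simp add: G_def j_def fun_eq_iff)
  have "complex_banach_space_on ?F sup_norm \<and> j ` ?E \<subseteq> ?F \<and> clinear_on ?E j \<and> (\<forall>v\<in>?E. sup_norm (j v) = ?N v)"
    using F.complex_banach_space_on_axioms jF j_lin j_norm by (intro conjI ballI)
  from P[unfolded P_space_def, THEN spec, THEN spec, THEN spec, THEN mp, OF this]
  obtain P where P: "P \<in> bounded_ops ?F sup_norm (j ` ?E) sup_norm" "\<forall>w\<in>j ` ?E. P w = w"
    "op_norm ?F sup_norm sup_norm P \<le> lam"
    by (elim bexE conjE)
  have P_lin: "clinear_on ?F P" using P(1) by (simp add: bounded_ops_def)
  have P_in: "P w \<in> j ` ?E" if "w \<in> ?F" for w using P(1) that by (auto simp: bounded_ops_def)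
  \<comment> \<open>The codomain is enlarged to \<open>?F\<close>, where \<open>sup_norm\<close> is
    already known to be a norm.\<close>
  have PF: "P \<in> bounded_ops ?F sup_norm ?F sup_norm" using P(1) order_trans[OF _ jF] by (simp add: bounded_ops_def)
  have "\<forall>z. \<exists>\<phi>. \<phi> \<in> ?E \<and> j \<phi> = P (G z)"
  proof
    fix z show "\<exists>\<phi>. \<phi> \<in> ?E \<and> j \<phi> = P (G z)" using P_in[OF GF, of z] by (elim imageE) auto
  qed
  \<comment> \<open>\<open>L\<close> is \<open>P\<close> after \<open>G\<close>, pulled back along
    \<open>j\<close>. Injectivity of \<open>j\<close>, a consequence of its being isometric, makes
    the pullback linear.\<close>
  from choice[OF this] obtain L where L: "\<And>z. L z \<in> ?E" "\<And>z. j (L z) = P (G z)" by blast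
  show ?thesis
  proof (intro exI[of _ L] conjI allI ballI)
    show "clinear_on UNIV L"
      unfolding clinear_on_def
    proof (intro conjI ballI allI)
      fix z w
      have "j (L (z + w)) = j (L z + L w)"
        using clinear_on_simps(1)[OF j_lin L(1) L(1)] clinear_on_simps(1)[OF P_lin GF GF]
        by (simp add: L(2) G_lin)
      then show "L (z + w) = L z + L w" by (intro j_inj L csubspace_memI(2)[OF E.csubspace])
    next
      fix a z
      have "j (L (a *\<^sub>C z)) = j (a *\<^sub>C L z)"
        using clinear_on_simps(2)[OF j_lin L(1)] clinear_on_simps(2)[OF P_lin GF]
        by (simp add: L(2) G_lin)
      then show "L (a *\<^sub>C z) = a *\<^sub>C L z" by (intro j_inj L csubspace_memI(3)[OF E.csubspace])
    qed
    fix z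
    show "L z \<in> ?E" by (rule L)
    have nn: "0 \<le> op_norm ?F sup_norm sup_norm P"
      by (rule op_norm_nonneg[OF F.complex_normed_space_on_axioms F.complex_normed_space_on_axioms PF])
    have "?N (L z) = sup_norm (P (G z))" using j_norm[OF L(1)] L(2) by simp
    also have "\<dots> \<le> op_norm ?F sup_norm sup_norm P * sup_norm (G z)"
      by (rule op_norm_bound[OF F.complex_normed_space_on_axioms F.complex_normed_space_on_axioms PF GF])
    also have "\<dots> \<le> lam * norm z"
      using nn P(3) sup_norm_leI[OF G_le] sup_norm_nonneg[OF GF] by (intro mult_mono) auto
    finally show "?N (L z) \<le> lam * norm z" .
  next
    fix x f assume x: "x \<in> X" and f: "f \<in> dual X norm"
    note Jx = evaluation_bidual[OF XN x]
    have "j (L x) = j (?J x)" using L(2)[of x] G_X[OF x] P(2) Jx by simp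
    from j_inj[OF L(1) Jx this] show "L x f = f x" using f by simp
  qed
qed

text \<open>\<open>T'\<close> is quantified before \<open>y\<close>, which is the form that a
  passage to infima needs. Letting \<open>y\<close> range over all of \<open>ell_w\<close> includes
  the strongly p-summable sequences, so one statement serves both parts.\<close>

lemma weakly_compact_extension:
  fixes X :: "'z::cbanach set" and T :: "'z \<Rightarrow> 'y::cbanach"
  assumes X: "csubspace X" and lam: "1 \<le> lam"
    and P: "P_space lam (bidual X norm) (bidual_norm X norm)" and p: "1 < p"
    and T: "T \<in> W_ops p X"
  shows "\<exists>T'\<in>bounded_ops UNIV norm UNIV norm. (\<forall>x\<in>X. T' x = T x) \<and>
    (\<forall>y\<in>ell_w p. dominates p X T y \<longrightarrow> dominates p UNIV T' (\<lambda>n. complex_of_real lam *\<^sub>C y n))"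
proof -
  have XN: "complex_normed_space_on X norm"
    by (rule complex_normed_space_on_subset[OF complex_normed_space_on_UNIV X]) simp
  interpret DX: complex_normed_space_on "dual X norm" "dual_norm X norm"
    by (rule complex_normed_space_on_dual[OF XN])
  obtain L where L: "clinear_on UNIV L" "\<And>z. L z \<in> bidual X norm"
    "\<And>z. bidual_norm X norm (L z) \<le> lam * norm z" "\<And>x f. x \<in> X \<Longrightarrow> f \<in> dual X norm \<Longrightarrow> L x f = f x"
    using P_space_bidual_extension[OF X P] by blast
  obtain y0 where y0: "y0 \<in> ell_w p" "dominates p X T y0" and bT: "T \<in> bounded_ops X norm UNIV norm"
    using T by (auto simp: W_ops_def)
  have lin_T: "clinear_on X T" using bT by (simp add: bounded_ops_def)
  note adj = adjoint_on_dual[OF XN bT]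
  \<comment> \<open>Here \<open>y0\<close> shows that the second adjoint of \<open>T\<close> sends
    \<open>L z\<close> into the codomain of \<open>T\<close>. The identity characterising
    \<open>v\<close> does not mention \<open>y0\<close>.\<close>
  have "\<exists>v. \<forall>g\<in>dual UNIV norm. g v = L z (adjoint_on X T g)" for z
    using second_adjoint_E_op[OF X bT y0(1) p y0(2) L(2)[of z]] by blast
  then obtain T' where T': "\<And>z g. g \<in> dual UNIV norm \<Longrightarrow> g (T' z) = L z (adjoint_on X T g)"
    by metis
  have "clinear_on UNIV T'"
    unfolding clinear_on_def
  proof (intro conjI ballI allI)
    fix z w
    show "T' (z + w) = T' z + T' w"
    proof (rule dual_separates)
      fix g :: "'y \<Rightarrow> complex" assume g: "g \<in> dual UNIV norm"
      have "g (T' z + T' w) = g (T' z) + g (T' w)" by (rule clinear_on_simps(1)[OF dual_clinear[OF g]]) simp_all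
      moreover have "L (z + w) = L z + L w" by (rule clinear_on_simps(1)[OF L(1)]) simp_all
      ultimately show "g (T' (z + w)) = g (T' z + T' w)" by (simp add: T'[OF g])
    qed
  next
    fix a z
    show "T' (a *\<^sub>C z) = a *\<^sub>C T' z"
    proof (rule dual_separates)
      fix g :: "'y \<Rightarrow> complex" assume g: "g \<in> dual UNIV norm"
      have "g (a *\<^sub>C T' z) = a *\<^sub>C g (T' z)" by (rule clinear_on_simps(2)[OF dual_clinear[OF g]]) simp
      moreover have "L (a *\<^sub>C z) = a *\<^sub>C L z" by (rule clinear_on_simps(2)[OF L(1)]) simp
      ultimately show "g (T' (a *\<^sub>C z)) = g (a *\<^sub>C T' z)" by (simp add: T'[OF g] scaleC_fun_def)
    qed
  qed
  \<comment> \<open>A norming functional converts the weak description of \<open>T' z\<close> into a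
    norm bound, with the bound of \<open>L\<close> times the weak norm of \<open>y0\<close> as
    constant.\<close>
  moreover have "norm (T' z) \<le> (lam * norm_w p y0) * norm z" for z
  proof -
    obtain g where g: "g \<in> dual_ball" "g (T' z) = complex_of_real (norm (T' z))"
      using exists_norming_functional by blast
    note gd = dual_ball_bound(1)[OF g(1)]
    have "norm (T' z) = cmod (L z (adjoint_on X T g))" unfolding T'[OF gd, symmetric] g(2) by simp
    also have "\<dots> \<le> bidual_norm X norm (L z) * dual_norm X norm (adjoint_on X T g)"
      using L(2)[of z] unfolding bidual_def bidual_norm_def
      by (rule dual_bound[OF DX.complex_normed_space_on_axioms _ adj[OF gd]])
    also have "\<dots> \<le> (lam * norm z) * norm_w p y0"
    proof (rule mult_mono[OF L(3)])
      show "dual_norm X norm (adjoint_on X T g) \<le> norm_w p y0"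
        using adjoint_on_norm_le[OF X lin_T y0(1) p y0(2) gd] norm_s_le_norm_w[OF y0(1) g(1)] by simp
      show "0 \<le> dual_norm X norm (adjoint_on X T g)" by (rule DX.nonneg[OF adj[OF gd]])
    qed (use lam in simp)
    finally show ?thesis by (simp add: mult_ac)
  qed
  ultimately have "T' \<in> bounded_ops UNIV norm UNIV norm"
    unfolding bounded_ops_def by (intro CollectI conjI exI ballI) simp_all
  moreover have "T' x = T x" if x: "x \<in> X" for x
  proof (rule dual_separates)
    fix g :: "'y \<Rightarrow> complex" assume g: "g \<in> dual UNIV norm"
    show "g (T' x) = g (T x)" using L(4)[OF x adj[OF g]] x by (simp add: T'[OF g] adjoint_on_def)
  qed
  moreover have "dominates p UNIV T' (\<lambda>n. complex_of_real lam *\<^sub>C y n)"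
    if y: "y \<in> ell_w p" and dom: "dominates p X T y" for y
    unfolding dominates_def
  proof (intro subsetI, elim imageE)
    fix z v assume z: "z \<in> {z \<in> UNIV. norm z \<le> 1}" and v: "v = T' z"
    obtain \<alpha> where \<alpha>: "\<alpha> \<in> ell_s (conj_exp p)" "norm_s (conj_exp p) \<alpha> \<le> bidual_norm X norm (L z)"
      "\<And>g. g \<in> dual UNIV norm \<Longrightarrow> g (E_op y \<alpha>) = L z (adjoint_on X T g)"
      using second_adjoint_E_op[OF X bT y p dom L(2)[of z]] by blast
    \<comment> \<open>The coefficients \<open>\<alpha>\<close> have q-norm at most
      \<open>lam\<close>; dividing them by \<open>lam\<close> places them in the unit ball, and
      multiplying \<open>y\<close> by \<open>lam\<close> compensates.\<close>
    let ?l = "complex_of_real (inverse lam)"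
    let ?\<beta> = "\<lambda>n. ?l *\<^sub>C \<alpha> n"
    have l: "cmod ?l = inverse lam" unfolding norm_of_real using lam by simp
    have "norm_s (conj_exp p) \<alpha> \<le> lam * norm z" using \<alpha>(2) L(3)[of z] by simp
    also have "\<dots> \<le> lam * 1" using z lam by (intro mult_left_mono) auto
    finally have "norm_s (conj_exp p) ?\<beta> \<le> 1"
      unfolding ell_s_scale(2)[OF \<alpha>(1) conj_exp_gt_1[OF p]] l using lam by (simp add: field_simps)
    then have "?\<beta> \<in> ell_ball (conj_exp p)"
      using ell_s_scale(1)[OF \<alpha>(1) conj_exp_gt_1[OF p]] by (simp add: ell_ball_def)
    moreover have "T' z = E_op y \<alpha>"
    proof (rule dual_separates)
      fix g :: "'y \<Rightarrow> complex" assume g: "g \<in> dual UNIV norm"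
      show "g (T' z) = g (E_op y \<alpha>)" by (simp only: T'[OF g] \<alpha>(3)[OF g])
    qed
    moreover have "E_op (\<lambda>n. complex_of_real lam *\<^sub>C y n) ?\<beta> = E_op y \<alpha>"
    proof -
      have "?\<beta> n * complex_of_real lam = \<alpha> n" for n
        using lam by (simp add: scaleC_complex_def field_simps)
      then show ?thesis by (simp only: E_op_def scaleC_scaleC)
    qed
    ultimately show "v \<in> E_op (\<lambda>n. complex_of_real lam *\<^sub>C y n) ` ell_ball (conj_exp p)"
      unfolding v by (intro image_eqI[of _ _ ?\<beta>]) simp_all
  qed
  ultimately show ?thesis by blast
qed

section \<open>Scaling of sequences and comparison of infima\<close>

lemma ell_w_scale:
  fixes y :: "nat \<Rightarrow> 'y::complex_normed_vector"
  assumes y: "y \<in> ell_w p" and p: "1 < p"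
  shows "(\<lambda>n. a *\<^sub>C y n) \<in> ell_w p" and "norm_w p (\<lambda>n. a *\<^sub>C y n) \<le> cmod a * norm_w p y"
proof -
  have eq: "g (a *\<^sub>C y n) = a *\<^sub>C g (y n)" if "g \<in> dual_ball" for g n
    using clinear_on_simps(2)[OF dual_clinear[OF dual_ball_bound(1)[OF that]]] by simp
  have mem: "(\<lambda>n. g (a *\<^sub>C y n)) \<in> ell_s p" if g: "g \<in> dual_ball" for g
    using ell_s_scale(1)[OF ell_w_dual[OF y p dual_ball_bound(1)[OF g]] p] by (simp add: eq[OF g])
  have le: "norm_s p (\<lambda>n. g (a *\<^sub>C y n)) \<le> cmod a * norm_w p y" if g: "g \<in> dual_ball" for g
    unfolding eq[OF g] ell_s_scale(2)[OF ell_w_dual[OF y p dual_ball_bound(1)[OF g]] p]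
    by (intro mult_left_mono norm_s_le_norm_w[OF y g]) simp
  show "(\<lambda>n. a *\<^sub>C y n) \<in> ell_w p" unfolding ell_w_eq using mem bdd_aboveI2[OF le] by simp
  show "norm_w p (\<lambda>n. a *\<^sub>C y n) \<le> cmod a * norm_w p y"
    unfolding norm_w_eq[of p "\<lambda>n. a *\<^sub>C y n"] by (rule cSUP_least[OF dual_ball_nonempty le])
qed

text \<open>Applied with \<open>A\<close> and \<open>B\<close> the norms of the sequences dominating
  \<open>T\<close> and its extension. Nonnegativity of \<open>B\<close> provides the lower bound,
  and nonemptiness of \<open>A\<close> the greatest-lower-bound property, for real infima.\<close>

lemma Inf_scaled_le:
  fixes A B :: "real set"
  assumes "A \<noteq> {}" and "0 < c" and "\<And>b. b \<in> B \<Longrightarrow> 0 \<le> b"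
    and "\<And>a. a \<in> A \<Longrightarrow> \<exists>b\<in>B. b \<le> c * a"
  shows "Inf B \<le> c * Inf A"
proof -
  have "Inf B / c \<le> a" if "a \<in> A" for a
  proof -
    obtain b where b: "b \<in> B" "b \<le> c * a" using assms(4)[OF \<open>a \<in> A\<close>] by blast
    have "Inf B \<le> b" using b(1) assms(3) by (intro cInf_lower bdd_belowI)
    then show ?thesis using b(2) assms(2) by (simp add: field_simps)
  qed
  then have "Inf B / c \<le> Inf A" by (intro cInf_greatest assms(1))
  then show ?thesis using assms(2) by (simp add: field_simps)
qed

theorem theorem1p8:
  fixes X :: "'z::cbanach set" and p lam :: real
  assumes "csubspace X" and "closed X"
    and "1 \<le> lam"
    and "P_space lam (bidual X norm) (bidual_norm X norm)"
    and "1 < p"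
  shows "(\<forall>T :: 'z \<Rightarrow> 'y::cbanach. T \<in> K_ops p X \<longrightarrow>
      (\<exists>T' \<in> K_ops p UNIV. (\<forall>x\<in>X. T' x = T x) \<and> kappa p UNIV T' \<le> lam * kappa p X T))
    \<and> (\<forall>T :: 'z \<Rightarrow> 'y. T \<in> W_ops p X \<longrightarrow>
      (\<exists>T' \<in> W_ops p UNIV. (\<forall>x\<in>X. T' x = T x) \<and> omega p UNIV T' \<le> lam * omega p X T))"
proof (intro conjI allI impI)
  let ?s = "\<lambda>(y :: nat \<Rightarrow> 'y) n. complex_of_real lam *\<^sub>C y n"
  note p = \<open>1 < p\<close>
  note extension = weakly_compact_extension[OF assms(1,3,4) p]
  note sub = ell_s_subset_ell_w[OF p]
  have lam: "0 < lam" using assms(3) by simp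
  {
    fix T :: "'z \<Rightarrow> 'y" assume T: "T \<in> K_ops p X"
    then obtain y0 where y0: "y0 \<in> ell_s p" "dominates p X T y0" by (auto simp: K_ops_def)
    \<comment> \<open>The extension obtained for \<open>T\<close> as a weakly p-compact operator is
      again p-compact: scaling by \<open>lam\<close> keeps a strongly p-summable dominating sequence
      strongly p-summable.\<close>
    have "T \<in> W_ops p X" using T sub by (auto simp: K_ops_def W_ops_def)
    from extension[OF this] obtain T' where T': "T' \<in> bounded_ops UNIV norm UNIV norm" "\<forall>x\<in>X. T' x = T x"
      and dom: "\<And>y. y \<in> ell_w p \<Longrightarrow> dominates p X T y \<Longrightarrow> dominates p UNIV T' (?s y)" by blast
    have dom': "dominates p UNIV T' (?s y)" if "y \<in> ell_s p" "dominates p X T y" for y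
      using dom that sub by blast
    show "\<exists>T' \<in> K_ops p UNIV. (\<forall>x\<in>X. T' x = T x) \<and> kappa p UNIV T' \<le> lam * kappa p X T"
    proof (intro bexI[of _ T'] conjI)
      show "T' \<in> K_ops p UNIV"
        using T'(1) dom'[OF y0] ell_s_scale(1)[OF y0(1) p] unfolding K_ops_def by blast
      show "kappa p UNIV T' \<le> lam * kappa p X T"
        unfolding kappa_def
      proof (rule Inf_scaled_le[OF _ lam])
        fix a assume "a \<in> {norm_s p y |y. y \<in> ell_s p \<and> dominates p X T y}"
        then obtain y where y: "y \<in> ell_s p" "dominates p X T y" "a = norm_s p y" by blast
        show "\<exists>b\<in>{norm_s p y |y. y \<in> ell_s p \<and> dominates p UNIV T' y}. b \<le> lam * a"
        proof (intro bexI CollectI exI conjI refl)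
          show "?s y \<in> ell_s p" by (rule ell_s_scale(1)[OF y(1) p])
          show "norm_s p (?s y) \<le> lam * a"
            using ell_s_scale(2)[OF y(1) p, of "complex_of_real lam"] lam y(3) by simp
        qed (rule refl dom'[OF y(1,2)])+
      qed (use y0 norm_s_nonneg in auto)
    qed (rule T'(2))
  next
    fix T :: "'z \<Rightarrow> 'y" assume T: "T \<in> W_ops p X"
    then obtain y0 where y0: "y0 \<in> ell_w p" "dominates p X T y0" by (auto simp: W_ops_def)
    from extension[OF T] obtain T' where T': "T' \<in> bounded_ops UNIV norm UNIV norm" "\<forall>x\<in>X. T' x = T x"
      and dom: "\<And>y. y \<in> ell_w p \<Longrightarrow> dominates p X T y \<Longrightarrow> dominates p UNIV T' (?s y)" by blast
    show "\<exists>T' \<in> W_ops p UNIV. (\<forall>x\<in>X. T' x = T x) \<and> omega p UNIV T' \<le> lam * omega p X T"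
    proof (intro bexI[of _ T'] conjI)
      show "T' \<in> W_ops p UNIV"
        using T'(1) dom[OF y0] ell_w_scale(1)[OF y0(1) p] unfolding W_ops_def by blast
      show "omega p UNIV T' \<le> lam * omega p X T"
        unfolding omega_def
      proof (rule Inf_scaled_le[OF _ lam])
        fix a assume "a \<in> {norm_w p y |y. y \<in> ell_w p \<and> dominates p X T y}"
        then obtain y where y: "y \<in> ell_w p" "dominates p X T y" "a = norm_w p y" by blast
        show "\<exists>b\<in>{norm_w p y |y. y \<in> ell_w p \<and> dominates p UNIV T' y}. b \<le> lam * a"
        proof (intro bexI CollectI exI conjI refl)
          show "?s y \<in> ell_w p" by (rule ell_w_scale(1)[OF y(1) p])
          show "norm_w p (?s y) \<le> lam * a"
            using ell_w_scale(2)[OF y(1) p, of "complex_of_real lam"] lam y(3) by simp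
        qed (rule refl dom[OF y(1,2)])+
      qed (use y0 norm_w_nonneg in auto)
    qed (rule T'(2))
  }
qed

end
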